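(* Let $\nu>0$ and $0<b<a$. Then, for any $\varepsilon\in\left(0,\frac{\nu}{1+\nu}\right)$, as $t\to\infty$, $$\mathbb{P}_a^{(\nu)}(t<\tau_b<\infty)=b^{2\nu}\left\{1-\left(\frac{b}{a}\right)^{2\nu}\right\}\frac{1}{\Gamma(1+\nu)(2t)^{\nu}}+O(t^{-\nu-\varepsilon}),$$ where $\Gamma$ denotes the usual Gamma function.
   Context: For $\nu\in\mathbb{R}$ and $a>0$, $\mathbb{P}_a^{(\nu)}$ denotes the probability law on the path space $W=C([0,\infty);\mathbb{R})$ of a Bessel process with index $\nu$ (equivalently, of dimension $\delta=2(\nu+1)$) starting from $a$, i.e. the diffusion on the positive half-line with generator $\frac12\frac{d^2}{dx^2}+\frac{2\nu+1}{2x}\frac{d}{dx}$. For $w\in W$ and $b>0$, the first hitting time of $b$ is $\tau_b=\tau_b(w)=\inf\{t>0: w(t)=b\}$, with $\inf\emptyset=\infty$. In the asymptotic statement $\nu,a,b,\varepsilon$ are fixed and the implied constant does not depend on $t$. *)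

theory Defs
  imports "HOL-Probability.Probability" "HOL-Library.Landau_Symbols"
begin

text \<open>
  The space \<open>W = C([0,\<infinity>); \<real>)\<close> with the \<open>\<sigma>\<close>-algebra generated by the coordinate maps
  \<open>w \<mapsto> w t\<close>, \<open>t \<ge> 0\<close>. Only the measurable-space structure is used; elements of the product
  space are extensional, so a path takes the value \<^term>\<open>undefined\<close> at negative times.
\<close>

definition path_space :: "(real \<Rightarrow> real) measure" where
  "path_space = restrict_space (\<Pi>\<^sub>M t\<in>{0..}. borel) {w. continuous_on {0..} w}"

definition path_filtration :: "real \<Rightarrow> (real \<Rightarrow> real) measure" where
  "path_filtration t =
     vimage_algebra (space path_space) (\<lambda>w. restrict w {0..t}) (\<Pi>\<^sub>M s\<in>{0..t}. borel)"

lemma subalgebra_path_filtration: "subalgebra path_space (path_filtration t)"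
proof -
  have "(\<lambda>w. restrict w {0..t}) \<in> path_space \<rightarrow>\<^sub>M (\<Pi>\<^sub>M s\<in>{0..t}. borel)"
    unfolding path_space_def
    by (intro measurable_restrict_space1 measurable_restrict_subset) auto
  then show ?thesis
    unfolding path_filtration_def subalgebra_def
    by (simp add: sets_image_in_sets)
qed

definition martingale ::
  "'a measure \<Rightarrow> (real \<Rightarrow> 'a measure) \<Rightarrow> (real \<Rightarrow> 'a \<Rightarrow> real) \<Rightarrow> bool" where
  "martingale P F M \<longleftrightarrow>
     (\<forall>t\<ge>0. M t \<in> borel_measurable (F t) \<and> integrable P (M t)) \<and>
     (\<forall>s t. 0 \<le> s \<longrightarrow> s \<le> t \<longrightarrow> (AE w in P. real_cond_exp P (F s) (M t) w = M s w))"

definition bessel_generator :: "real \<Rightarrow> (real \<Rightarrow> real) \<Rightarrow> real \<Rightarrow> real" where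
  "bessel_generator \<nu> f x = 1 / 2 * deriv (deriv f) x + (2 * \<nu> + 1) / (2 * x) * deriv f x"

text \<open>
  \<open>C\<^sup>2\<close> functions with compact support in the open half-line, extended by zero to \<open>\<real>\<close>.
\<close>

definition test_function :: "(real \<Rightarrow> real) \<Rightarrow> bool" where
  "test_function f \<longleftrightarrow>
     (\<forall>x. f differentiable at x) \<and> (\<forall>x. deriv f differentiable at x) \<and>
     continuous_on UNIV (deriv (deriv f)) \<and>
     compact (closure {x. f x \<noteq> 0}) \<and> closure {x. f x \<noteq> 0} \<subseteq> {0<..}"

text \<open>
  \<open>P\<close> is the law on path space of the diffusion on \<open>(0,\<infinity>)\<close> with generator
  \<^term>\<open>bessel_generator \<nu>\<close> started at \<open>a > 0\<close>, in the sense of the Stroock--Varadhan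
  martingale problem. This is the right notion for \<open>\<nu> \<ge> 0\<close>, when the boundary point \<open>0\<close>
  is not reached and no boundary condition is needed, so that the law is unique.
  For \<open>\<nu> < 0\<close> the process reaches \<open>0\<close> and no law satisfies the predicate.
\<close>

definition bessel_law :: "real \<Rightarrow> real \<Rightarrow> (real \<Rightarrow> real) measure \<Rightarrow> bool" where
  "bessel_law \<nu> a P \<longleftrightarrow>
     prob_space P \<and> sets P = sets path_space \<and>
     (AE w in P. w 0 = a) \<and> (AE w in P. \<forall>t\<ge>0. 0 < w t) \<and>
     (\<forall>f. test_function f \<longrightarrow>
        martingale P path_filtration
          (\<lambda>t w. f (w t) - f (w 0) - (LBINT s:{0..t}. bessel_generator \<nu> f (w s))))"

text \<open>The infimum is taken in \<^typ>\<open>ereal\<close>, so it is \<open>\<infinity>\<close> for a path that never hits \<open>b\<close>.\<close>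

definition hitting_time :: "real \<Rightarrow> (real \<Rightarrow> real) \<Rightarrow> ereal" where
  "hitting_time b w = Inf {ereal t | t. 0 < t \<and> w t = b}"

end

theory Submission
  imports Defs
begin

text \<open>
  Let \<open>\<tau>\<close> be the hitting time of \<open>b\<close>. Stopping the martingale \<open>R\<^sub>t powr (-2\<nu>)\<close> at \<open>\<tau>\<close> expresses
  \<open>P(\<tau> > T)\<close> by \<open>E[R\<^sub>T powr (-2\<nu>); \<tau> > T]\<close>. Stopping the space-time harmonic functions
  \<open>h(S - t, x)\<close>, where \<open>h(r, x) = r powr (-\<nu>-1) * exp (-x\<^sup>2 / 2r)\<close>, and integrating over \<open>S > T\<close>
  evaluates that expectation: with \<open>u(t, x) = \<integral> h(r, x) dr\<close> over \<open>r > t\<close>, so that \<open>u(0, x)\<close> is a multiple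
  of \<open>x powr (-2\<nu>)\<close>, one obtains
  \<open>u(0, b) * P(T < \<tau> < \<infinity>) = u(T, a) - E[u(T - \<tau>, b); \<tau> \<le> T]\<close>.
  Since \<open>u(t, x)\<close> is \<open>t powr (-\<nu>) / \<nu>\<close> up to \<open>O(t powr (-\<nu>-1))\<close>, the main term follows, and the
  error is controlled by \<open>P(s < \<tau> \<le> s + 1) = O(s powr (-\<nu>-1))\<close>, which is again the stopping
  identity for \<open>h\<close>, with \<open>S = s + 2\<close>. The stopping identities come
  from the martingale problem by discretising time, which deals with the stopping and the time
  dependence at once, and a cutoff in space.
\<close>

subsection \<open>Paths and exit times\<close>

text \<open>\<open>bessel_law\<close> gives martingales only for compactly supported functions of
  space and only at deterministic times. Discretisation fits this because staying in an open set up
  to a grid point is an event of the filtration at that grid point, so the martingale identity may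
  be localised on it. The scale function enters because the position of the paths surviving at time
  \<open>T\<close> is unknown: it occurs in both stopping identities through the same expectation,
  which drops out on subtraction and leaves the hitting time alone. The obstacle is a hit shortly
  before \<open>T\<close>. There \<open>u(T - \<tau>, b)\<close> is of order one, and the a priori
  bound \<open>O(T powr (-\<nu>))\<close> for late finite hitting times is as large as the main
  term. The bound for unit windows gains one more power of \<open>T\<close>, which makes the last
  stretch an error term. The exponent \<nu> / (1 + \<nu>) is where the cost of replacing
  \<open>T - \<tau>\<close> by \<open>T\<close> for early hits meets the cost of the hits in
  between.\<close>

lemma space_path_space:
  "space path_space = {w. continuous_on {0..} w} \<inter> extensional {0..}"
  by (simp add: path_space_def space_restrict_space space_PiM PiE_def)

lemma path_continuous: "w \<in> space path_space \<Longrightarrow> 0 \<le> c \<Longrightarrow> continuous_on {c..d} w"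
  unfolding space_path_space by (auto intro: continuous_on_subset)

lemma space_path_filtration [simp]: "space (path_filtration t) = space path_space"
  by (simp add: path_filtration_def)

lemma measurable_coordinate_filtration:
  assumes "0 \<le> r" "r \<le> t"
  shows "(\<lambda>w. w r) \<in> borel_measurable (path_filtration t)"
proof -
  have "(\<lambda>w. restrict w {0..t}) \<in> path_filtration t \<rightarrow>\<^sub>M (\<Pi>\<^sub>M s\<in>{0..t}. borel)"
    unfolding path_filtration_def by (rule measurable_vimage_algebra1) (auto simp: space_PiM)
  moreover have "(\<lambda>x. x r) \<in> (\<Pi>\<^sub>M s\<in>{0..t}. borel) \<rightarrow>\<^sub>M borel"
    using assms by (intro measurable_component_singleton) auto
  ultimately have "(\<lambda>w. restrict w {0..t} r) \<in> borel_measurable (path_filtration t)"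
    by (rule measurable_compose)
  then show ?thesis using assms by simp
qed

text \<open>By compactness and continuity, a path meets the closed set \<open>C\<close> on
  \<open>{c..d}\<close> iff its distance to \<open>C\<close> becomes arbitrarily small on a
  countable dense subset \<open>D\<close>. Since \<open>D\<close> lies in \<open>{c..d}\<close>,
  only coordinates up to \<open>t\<close> are consulted, which places the event in the filtration at
  \<open>t\<close>.\<close>

lemma hits_closed_measurable:
  fixes C :: "real set"
  assumes "0 \<le> c" "d \<le> t" "closed C"
  shows "{w \<in> space path_space. \<exists>s\<in>{c..d}. w s \<in> C} \<in> sets (path_filtration t)"
proof (cases "C = {} \<or> d < c")
  case True
  then have "{w \<in> space path_space. \<exists>s\<in>{c..d}. w s \<in> C} = {}" by auto
  then show ?thesis by (metis sets.empty_sets)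
next
  \<comment> \<open>\<open>infdist\<close> to the empty set is 0 by convention, so the distance
    criterion below would be wrong for empty \<open>C\<close>.\<close>
  case False
  obtain D where D: "countable D" "D \<subseteq> {c..d}" "{c..d} \<subseteq> closure D"
    using separable[of "{c..d}"] by metis
  have eq: "(\<exists>s\<in>{c..d}. w s \<in> C) \<longleftrightarrow> (\<forall>m. \<exists>q\<in>D. infdist (w q) C < inverse (real (Suc m)))"
    if w: "w \<in> space path_space" for w
  proof
    assume "\<exists>s\<in>{c..d}. w s \<in> C"
    then obtain s where s: "s \<in> {c..d}" "w s \<in> C" by auto
    show "\<forall>m. \<exists>q\<in>D. infdist (w q) C < inverse (real (Suc m))"
    proof
      fix m
      have "0 < inverse (real (Suc m))" by simp
      then obtain \<delta> where \<delta>: "\<delta> > 0"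
        "\<And>x. x \<in> {c..d} \<Longrightarrow> dist x s < \<delta> \<Longrightarrow> dist (w x) (w s) < inverse (real (Suc m))"
        using path_continuous[OF w \<open>0 \<le> c\<close>, of d] s(1) unfolding continuous_on_iff by meson
      obtain q where q: "q \<in> D" "dist q s < \<delta>"
        using D(3) s(1) \<delta>(1) closure_approachable by blast
      have "infdist (w q) C \<le> dist (w q) (w s)" using s(2) by (rule infdist_le)
      also have "\<dots> < inverse (real (Suc m))" using \<delta>(2)[of q] q D(2) by auto
      finally show "\<exists>q\<in>D. infdist (w q) C < inverse (real (Suc m))" using q(1) by auto
    qed
  next
    assume R: "\<forall>m. \<exists>q\<in>D. infdist (w q) C < inverse (real (Suc m))"
    have "continuous_on {c..d} (\<lambda>s. infdist (w s) C)"
      by (intro continuous_on_infdist path_continuous w assms)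
    then have "\<exists>s\<in>{c..d}. \<forall>x\<in>{c..d}. infdist (w s) C \<le> infdist (w x) C"
      using False by (intro continuous_attains_inf) auto
    then obtain s where s: "s \<in> {c..d}" "\<forall>x\<in>{c..d}. infdist (w s) C \<le> infdist (w x) C"
      by auto
    have *: "infdist (w s) C < inverse (real (Suc m))" for m
    proof -
      obtain q where q: "q \<in> D" "infdist (w q) C < inverse (real (Suc m))"
        using R[rule_format, of m] by auto
      then have "q \<in> {c..d}" using D(2) by auto
      then show ?thesis using s(2)[rule_format, of q] q(2) by linarith
    qed
    have "infdist (w s) C \<le> 0"
    proof (rule ccontr)
      assume "\<not> infdist (w s) C \<le> 0"
      then obtain m where "inverse (real (Suc m)) < infdist (w s) C"
        using reals_Archimedean[of "infdist (w s) C"] by auto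
      then show False using *[of m] by linarith
    qed
    then have "infdist (w s) C = 0" using infdist_nonneg[of "w s" C] by linarith
    then show "\<exists>s\<in>{c..d}. w s \<in> C"
      using s(1) in_closed_iff_infdist_zero[OF \<open>closed C\<close>] False by blast
  qed
  have meas: "(\<lambda>w. infdist (w q) C) \<in> borel_measurable (path_filtration t)" if "q \<in> D" for q
    using D(2) assms that
    by (intro borel_measurable_continuous_on[of "\<lambda>x. infdist x C"]
        measurable_coordinate_filtration continuous_on_infdist continuous_on_id) auto
  have "{w \<in> space (path_filtration t). \<forall>m. \<exists>q\<in>D. infdist (w q) C < inverse (real (Suc m))}
      \<in> sets (path_filtration t)"
    by (intro sets.sets_Collect_countable_All sets.sets_Collect_countable_Ex' D(1)
        borel_measurable_less meas borel_measurable_const)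
  also have "{w \<in> space (path_filtration t). \<forall>m. \<exists>q\<in>D. infdist (w q) C < inverse (real (Suc m))}
      = {w \<in> space path_space. \<exists>s\<in>{c..d}. w s \<in> C}"
    unfolding space_path_filtration using eq by blast
  finally show ?thesis .
qed

lemma stays_open_measurable:
  fixes U :: "real set"
  assumes "0 \<le> c" "d \<le> t" "open U"
  shows "{w \<in> space path_space. \<forall>s\<in>{c..d}. w s \<in> U} \<in> sets (path_filtration t)"
proof -
  have "{w \<in> space path_space. \<forall>s\<in>{c..d}. w s \<in> U} =
      space (path_filtration t) - {w \<in> space path_space. \<exists>s\<in>{c..d}. w s \<in> - U}"
    by auto
  also have "\<dots> \<in> sets (path_filtration t)"
    using assms by (intro sets.compl_sets hits_closed_measurable) auto
  finally show ?thesis .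
qed

text \<open>Inserting \<open>T\<close> truncates at the horizon and keeps the set nonempty, so the
  infimum is a real number in \<open>{0..T}\<close> for every path (if \<open>0 \<le> T\<close>).
  The value \<open>T\<close> is ambiguous: the path may have stayed in \<open>U\<close> throughout
  or have left it exactly at \<open>T\<close>.\<close>

definition exit_time :: "real set \<Rightarrow> real \<Rightarrow> (real \<Rightarrow> real) \<Rightarrow> real" where
  "exit_time U T w = Inf (insert T {s \<in> {0..T}. w s \<notin> U})"

lemma exit_time_bounds:
  assumes "0 \<le> T" shows "0 \<le> exit_time U T w" "exit_time U T w \<le> T"
proof -
  have b: "bdd_below (insert T {s \<in> {0..T}. w s \<notin> U})" using assms by (intro bdd_belowI[of _ 0]) auto
  show "0 \<le> exit_time U T w" unfolding exit_time_def using assms by (intro cInf_greatest) auto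
  show "exit_time U T w \<le> T" unfolding exit_time_def using b by (intro cInf_lower) auto
qed

lemma before_exit_time:
  assumes "0 \<le> s" "s < exit_time U T w" "0 \<le> T" shows "w s \<in> U"
proof (rule ccontr)
  assume *: "w s \<notin> U"
  have "s \<le> T" using assms exit_time_bounds(2)[of T U w] by linarith
  have b: "bdd_below (insert T {s \<in> {0..T}. w s \<notin> U})" using assms by (intro bdd_belowI[of _ 0]) auto
  have "exit_time U T w \<le> s"
    unfolding exit_time_def using b * \<open>s \<le> T\<close> assms by (intro cInf_lower) auto
  then show False using assms by simp
qed

lemma at_exit_time:
  assumes w: "continuous_on {0..T} w" and U: "open U" and T: "0 \<le> T" "exit_time U T w < T"
  shows "w (exit_time U T w) \<notin> U"
proof -
  let ?S = "insert T {s \<in> {0..T}. w s \<notin> U}"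
  have "closed ({0..T} \<inter> w -` (- U))"
    using w U by (intro continuous_closed_preimage) auto
  then have "closed (insert T ({0..T} \<inter> w -` (- U)))" by auto
  also have "insert T ({0..T} \<inter> w -` (- U)) = ?S" by auto
  finally have cl: "closed ?S" .
  have b: "bdd_below ?S" using assms by (intro bdd_belowI[of _ 0]) auto
  have "Inf ?S \<in> ?S"
    by (rule closed_contains_Inf[OF _ b cl]) auto
  then show ?thesis using T unfolding exit_time_def by auto
qed

text \<open>The complement of \<open>U\<close> is closed, so an exit before \<open>T\<close> is
  attained and already violates the right-hand side. This turns comparisons with the exit time into
  the events of \<open>stays_open_measurable\<close>.\<close>

lemma less_exit_time_iff:
  assumes w: "continuous_on {0..T} w" and U: "open U" and t: "0 \<le> t" "t < T"
  shows "t < exit_time U T w \<longleftrightarrow> (\<forall>s\<in>{0..t}. w s \<in> U)"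
proof
  show "\<forall>s\<in>{0..t}. w s \<in> U" if "t < exit_time U T w"
    using before_exit_time[of _ U T w] that t by auto
  show "t < exit_time U T w" if R: "\<forall>s\<in>{0..t}. w s \<in> U"
  proof (rule ccontr)
    assume "\<not> t < exit_time U T w"
    then have "exit_time U T w \<le> t" by simp
    moreover have "w (exit_time U T w) \<notin> U"
      using at_exit_time[OF w U] t calculation by auto
    ultimately show False using R exit_time_bounds(1)[of T U w] t by auto
  qed
qed

lemma exit_time_measurable:
  assumes "0 \<le> T" "open U"
  shows "exit_time U T \<in> borel_measurable (path_filtration T)"
proof (rule borel_measurableI_greater)
  fix y :: real
  consider "y < 0" | "0 \<le> y" "y < T" | "T \<le> y" by linarith
  then show "{w \<in> space (path_filtration T). y < exit_time U T w} \<in> sets (path_filtration T)"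
  proof cases
    case 1
    then have "y < exit_time U T w" for w using exit_time_bounds(1)[OF assms(1), of U w] by linarith
    then show ?thesis using sets.top[of "path_filtration T"] by simp
  next
    case 2
    have "{w \<in> space (path_filtration T). y < exit_time U T w}
        = {w \<in> space path_space. \<forall>s\<in>{0..y}. w s \<in> U}"
      using less_exit_time_iff[where T = T and U = U and t = y] path_continuous 2 assms by auto
    then show ?thesis using stays_open_measurable[of 0 y T U] 2 assms by simp
  next
    case 3
    then have "\<not> y < exit_time U T w" for w using exit_time_bounds(2)[OF assms(1), of U w] by linarith
    then show ?thesis by simp
  qed
qed

subsection \<open>The martingale problem at deterministic times\<close>

lemma test_function_continuous:
  assumes "test_function f" shows "continuous_on UNIV f"
  using assms unfolding test_function_def
  by (auto simp: continuous_on_eq_continuous_at intro: differentiable_imp_continuous_within)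

locale bessel =
  fixes \<nu> a :: real and P :: "(real \<Rightarrow> real) measure"
  assumes law: "bessel_law \<nu> a P" and index_pos: "0 < \<nu>"
begin

sublocale prob_space P
  using law unfolding bessel_law_def by simp

lemma sets_P: "sets P = sets path_space"
  using law unfolding bessel_law_def by simp

lemma space_P [simp]: "space P = space path_space"
  by (rule sets_eq_imp_space_eq[OF sets_P])

lemma subalgebra_P: "subalgebra P (path_filtration t)"
  using subalgebra_path_filtration[of t] sets_P unfolding subalgebra_def by simp

lemma sets_filtration_P: "A \<in> sets (path_filtration t) \<Longrightarrow> A \<in> sets P"
  using subalgebra_P[of t] unfolding subalgebra_def by auto

lemma borel_measurable_filtration_P:
  "f \<in> borel_measurable (path_filtration t) \<Longrightarrow> f \<in> borel_measurable P"
  by (rule measurable_from_subalg[OF subalgebra_P])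

lemma coordinate_measurable: "0 \<le> t \<Longrightarrow> (\<lambda>w. w t) \<in> borel_measurable P"
  by (rule borel_measurable_filtration_P[OF measurable_coordinate_filtration[of t t]]) auto

lemma start: "AE w in P. w 0 = a"
  using law unfolding bessel_law_def by simp

text \<open>Dynkin's formula between two deterministic times, localised on an event known at the
  earlier one; \<open>f (w 0)\<close> and the integral up to \<open>s\<close> cancel in the
  increment of the martingale.\<close>

lemma martingale_increment:
  assumes f: "test_function f" and gen: "continuous_on UNIV (bessel_generator \<nu> f)"
    and st: "0 \<le> s" "s \<le> t" and A: "A \<in> sets (path_filtration s)"
  shows "integrable P (\<lambda>w. f (w t))"
    "integrable P (\<lambda>w. integral {s..t} (\<lambda>r. bessel_generator \<nu> f (w r)))"
    "(\<integral>w. indicator A w * (f (w t) - f (w s)) \<partial>P)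
      = (\<integral>w. indicator A w * integral {s..t} (\<lambda>r. bessel_generator \<nu> f (w r)) \<partial>P)"
proof -
  let ?L = "bessel_generator \<nu> f"
  define M :: "real \<Rightarrow> (real \<Rightarrow> real) \<Rightarrow> real" where "M t w = f (w t) - f (w 0) - (LBINT s:{0..t}. ?L (w s))" for t w
  have mart: "martingale P path_filtration M"
    using law f unfolding bessel_law_def M_def by simp
  have Mint: "integrable P (M r)" if "0 \<le> r" for r
    using mart that unfolding martingale_def by simp
  interpret S: finite_measure_subalgebra P "path_filtration s"
    by unfold_locales (rule subalgebra_P)
  have AP: "A \<in> sets P" by (rule sets_filtration_P[OF A])
  have "(\<integral>w\<in>A. M t w \<partial>P) = (\<integral>w\<in>A. real_cond_exp P (path_filtration s) (M t) w \<partial>P)"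
    using st A by (intro S.real_cond_exp_intA Mint) auto
  also have "\<dots> = (\<integral>w\<in>A. M s w \<partial>P)"
  proof (rule set_lebesgue_integral_cong_AE)
    have "AE w in P. real_cond_exp P (path_filtration s) (M t) w = M s w"
      using mart st unfolding martingale_def by simp
    then show "AE w\<in>A in P. real_cond_exp P (path_filtration s) (M t) w = M s w"
      by eventually_elim simp
  qed (use AP Mint st in auto)
  finally have eq: "(\<integral>w\<in>A. M t w \<partial>P) = (\<integral>w\<in>A. M s w \<partial>P)" .
  have fmeas: "f \<in> borel_measurable borel"
    using test_function_continuous[OF f] by (rule borel_measurable_continuous_onI)
  \<comment> \<open>\<open>f\<close> is bounded, hence each \<open>f (w r)\<close> is integrable by
    itself; the martingale property only provides this for the combination \<open>M\<close>.\<close>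
  have cl: "compact (closure {x. f x \<noteq> 0})" using f unfolding test_function_def by simp
  have "compact (f ` closure {x. f x \<noteq> 0})"
    using test_function_continuous[OF f]
    by (intro compact_continuous_image cl) (auto intro: continuous_on_subset)
  then obtain B where B: "\<forall>y\<in>f ` closure {x. f x \<noteq> 0}. norm y \<le> B"
    using compact_imp_bounded bounded_iff by blast
  have B': "\<bar>f x\<bar> \<le> \<bar>B\<bar>" for x
  proof (cases "f x = 0")
    case False
    then have "x \<in> closure {x. f x \<noteq> 0}" using closure_subset[of "{x. f x \<noteq> 0}"] by auto
    then show ?thesis using B by force
  qed simp
  have fint: "integrable P (\<lambda>w. f (w r))" if "0 \<le> r" for r
    using B' by (intro integrable_const_bound[where B="\<bar>B\<bar>"] measurable_compose[OF coordinate_measurable fmeas])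
      (auto simp: that)
  show "integrable P (\<lambda>w. f (w t))" using fint st by simp
  have path: "integral {s..t} (\<lambda>r. ?L (w r)) = (f (w t) - f (w s)) - (M t w - M s w)"
    if w: "w \<in> space P" for w
  proof -
    have cont: "continuous_on {0..r} (\<lambda>r. ?L (w r))" for r
      using w by (intro continuous_on_compose2[OF gen path_continuous]) auto
    have "(LBINT r:{0..u}. ?L (w r)) = integral {0..u} (\<lambda>r. ?L (w r))" for u
      by (intro set_borel_integral_eq_integral borel_integrable_atLeastAtMost' cont)
    moreover have "integral {0..s} (\<lambda>r. ?L (w r)) + integral {s..t} (\<lambda>r. ?L (w r))
        = integral {0..t} (\<lambda>r. ?L (w r))"
      using st by (intro Henstock_Kurzweil_Integration.integral_combine integrable_continuous_real cont)
    ultimately show ?thesis unfolding M_def by simp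
  qed
  \<comment> \<open>Measurability and integrability of the path integral are read off from this
    expression, which bypasses joint measurability in time and path.\<close>
  have *: "integrable P (\<lambda>w. (f (w t) - f (w s)) - (M t w - M s w))"
    using fint Mint st by (intro Bochner_Integration.integrable_diff) auto
  show int: "integrable P (\<lambda>w. integral {s..t} (\<lambda>r. ?L (w r)))"
    by (rule Bochner_Integration.integrable_cong[OF refl path, THEN iffD2, OF _ *])
  have ind: "integrable P (\<lambda>w. indicator A w * g w)" if "integrable P g" for g :: "_ \<Rightarrow> real"
    using integrable_real_mult_indicator[OF AP that] by (simp add: mult.commute)
  have "(\<integral>w. indicator A w * integral {s..t} (\<lambda>r. ?L (w r)) \<partial>P)
      = (\<integral>w. indicator A w * (f (w t) - f (w s)) - (indicator A w * M t w - indicator A w * M s w) \<partial>P)"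
    by (intro Bochner_Integration.integral_cong refl) (simp only: path, simp add: algebra_simps)
  also have "\<dots> = (\<integral>w. indicator A w * (f (w t) - f (w s)) \<partial>P) -
      ((\<integral>w. indicator A w * M t w \<partial>P) - (\<integral>w. indicator A w * M s w \<partial>P))"
    using fint Mint st by (simp add: ind)
  also have "(\<integral>w. indicator A w * M t w \<partial>P) = (\<integral>w. indicator A w * M s w \<partial>P)"
    using eq unfolding set_lebesgue_integral_def by simp
  finally show "(\<integral>w. indicator A w * (f (w t) - f (w s)) \<partial>P)
      = (\<integral>w. indicator A w * integral {s..t} (\<lambda>r. ?L (w r)) \<partial>P)" by simp
qed

end

subsection \<open>Discretisation of a stopped path\<close>

text \<open>\<open>p j\<close> is the exit time rounded up to the grid. For \<open>k < n\<close> the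
  grid point \<open>p k\<close> lies before \<open>T\<close>, so staying in \<open>U\<close> up to
  \<open>p k\<close> means exactly \<open>k < j\<close>, and the weighted sum stops at
  \<open>j\<close>. The weight of the \<open>k\<close>-th term depends on the path up to
  \<open>p k\<close> only, as \<open>martingale_increment\<close> demands.\<close>

lemma grid_exit:
  fixes w :: "real \<Rightarrow> real" and p :: "nat \<Rightarrow> real"
  assumes w: "continuous_on {0..T} w" and U: "open U" and T: "0 < T" and n: "0 < n"
    and p: "\<And>k. p k = T * real k / real n"
  shows "\<exists>j. j \<le> n \<and> exit_time U T w \<le> p j \<and> p j \<le> exit_time U T w + T / n \<and>
    (\<forall>k<j. p k < exit_time U T w) \<and>
    (\<forall>g :: nat \<Rightarrow> real. (\<Sum>k<n. of_bool (\<forall>r\<in>{0..p k}. w r \<in> U) * g k) = (\<Sum>k<j. g k))"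
proof -
  let ?\<sigma> = "exit_time U T w"
  define j where "j = nat \<lceil>?\<sigma> * n / T\<rceil>"
  have \<sigma>: "0 \<le> ?\<sigma>" "?\<sigma> \<le> T" using exit_time_bounds[of T U w] T by auto
  have rj: "real j = of_int \<lceil>?\<sigma> * n / T\<rceil>"
    unfolding j_def using \<sigma> T by simp
  have "?\<sigma> * n / T \<le> n" using \<sigma> T n by (simp add: field_simps)
  then have jn: "j \<le> n" unfolding j_def by (simp add: nat_le_iff ceiling_le_iff)
  have lt: "p k < ?\<sigma> \<longleftrightarrow> k < j" for k
  proof -
    have "p k < ?\<sigma> \<longleftrightarrow> real k < ?\<sigma> * n / T" unfolding p using T n by (simp add: field_simps)
    also have "\<dots> \<longleftrightarrow> int k < \<lceil>?\<sigma> * n / T\<rceil>" by (simp add: less_ceiling_iff)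
    also have "\<dots> \<longleftrightarrow> k < j" unfolding j_def by linarith
    finally show ?thesis .
  qed
  have up: "p j \<le> ?\<sigma> + T / n"
  proof -
    have "real j \<le> ?\<sigma> * n / T + 1" unfolding rj by linarith
    then show ?thesis unfolding p using T n by (simp add: field_simps)
  qed
  have "(\<Sum>k<n. of_bool (\<forall>r\<in>{0..p k}. w r \<in> U) * g k) = (\<Sum>k<j. g k)" for g :: "nat \<Rightarrow> real"
  proof -
    have "(\<forall>r\<in>{0..p k}. w r \<in> U) \<longleftrightarrow> k < j" if "k < n" for k
    proof -
      have "0 \<le> p k" "p k < T" using that T n unfolding p by (auto simp: field_simps)
      then show ?thesis using less_exit_time_iff[OF w U, of "p k"] lt[of k] by simp
    qed
    then have "(\<Sum>k<n. of_bool (\<forall>r\<in>{0..p k}. w r \<in> U) * g k) = (\<Sum>k<n. of_bool (k < j) * g k)"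
      by (intro sum.cong) auto
    also have "\<dots> = (\<Sum>k<j. g k)"
      using jn by (intro sum.mono_neutral_cong_right) auto
    finally show ?thesis .
  qed
  moreover have "?\<sigma> \<le> p j" using lt[of j] by simp
  ultimately show ?thesis using jn up lt by (intro exI[of _ j]) auto
qed

text \<open>The sum telescopes to the value of \<open>g\<close> along the path at the rounded exit
  time, which converges to the exit time from above. The bound serves dominated convergence.\<close>

lemma stopped_sum_tendsto:
  fixes g :: "real \<Rightarrow> real \<Rightarrow> real"
  assumes w: "continuous_on {0..T} w" and U: "open U" and T: "0 < T"
    and g: "continuous_on ({0..T} \<times> UNIV) (\<lambda>(s, x). g s x)"
  defines "p \<equiv> \<lambda>n k. T * real k / real n"
  defines "S \<equiv> \<lambda>n. \<Sum>k<n. of_bool (\<forall>r\<in>{0..p n k}. w r \<in> U) *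
            (g (p n (Suc k)) (w (p n (Suc k))) - g (p n k) (w (p n k)))"
  shows "S \<longlonglongrightarrow> g (exit_time U T w) (w (exit_time U T w)) - g 0 (w 0)"
    and "(\<And>s x. s \<in> {0..T} \<Longrightarrow> \<bar>g s x\<bar> \<le> C) \<Longrightarrow> n > 0 \<Longrightarrow> \<bar>S n\<bar> \<le> 2 * C"
proof -
  let ?\<sigma> = "exit_time U T w"
  have \<sigma>: "0 \<le> ?\<sigma>" "?\<sigma> \<le> T" using exit_time_bounds[of T U w] T by auto
  have "\<exists>q. \<forall>n>0. q n \<in> {0..T} \<and> ?\<sigma> \<le> q n \<and> q n \<le> ?\<sigma> + T / n \<and> S n = g (q n) (w (q n)) - g 0 (w 0)"
  proof (intro choice allI)
    fix n
    show "\<exists>q. n > 0 \<longrightarrow> q \<in> {0..T} \<and> ?\<sigma> \<le> q \<and> q \<le> ?\<sigma> + T / n \<and> S n = g q (w q) - g 0 (w 0)"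
    proof (cases "n = 0")
      case False
      then have n: "n > 0" by simp
      have "p n k = T * real k / real n" for k by (simp add: p_def)
      note grid_exit[OF w U T n this]
      then obtain j where j: "j \<le> n" "?\<sigma> \<le> p n j" "p n j \<le> ?\<sigma> + T / n"
        "\<forall>k<j. p n k < ?\<sigma>"
        "\<forall>g :: nat \<Rightarrow> real. (\<Sum>k<n. of_bool (\<forall>r\<in>{0..p n k}. w r \<in> U) * g k) = (\<Sum>k<j. g k)"
        by (elim exE conjE)
      have "S n = g (p n j) (w (p n j)) - g (p n 0) (w (p n 0))"
        unfolding S_def j(5)[rule_format] by (rule sum_lessThan_telescope)
      moreover have "p n 0 = 0" by (simp add: p_def)
      moreover have "p n j \<in> {0..T}" using j(1) T n by (auto simp: p_def field_simps)
      ultimately show ?thesis using j by auto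
    qed simp
  qed
  then obtain q where *: "\<forall>n>0. q n \<in> {0..T} \<and> ?\<sigma> \<le> q n \<and> q n \<le> ?\<sigma> + T / n \<and>
      S n = g (q n) (w (q n)) - g 0 (w 0)" by (rule exE)
  have q: "q n \<in> {0..T}" "?\<sigma> \<le> q n" "q n \<le> ?\<sigma> + T / n" "S n = g (q n) (w (q n)) - g 0 (w 0)"
    if "n > 0" for n
    using *[rule_format, OF that] by auto
  have "(\<lambda>n. ?\<sigma> + T / real n) \<longlonglongrightarrow> ?\<sigma> + 0"
    by (intro tendsto_intros lim_const_over_n)
  then have "q \<longlonglongrightarrow> ?\<sigma>"
    using q(2,3) by (intro tendsto_sandwich[of "\<lambda>_. ?\<sigma>" q sequentially "\<lambda>n. ?\<sigma> + T / real n"])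
      (auto intro: eventually_sequentiallyI[of 1])
  moreover have "continuous_on {0..T} (\<lambda>s. (\<lambda>(s, x). g s x) (s, w s))"
    by (intro continuous_on_compose2[OF g] continuous_intros w) auto
  ultimately have "(\<lambda>n. g (q n) (w (q n))) \<longlonglongrightarrow> g ?\<sigma> (w ?\<sigma>)"
    using q(1) \<sigma>
    by (intro continuous_on_tendsto_compose[of "{0..T}" "\<lambda>s. g s (w s)"])
      (auto intro: eventually_sequentiallyI[of 1])
  then have "(\<lambda>n. g (q n) (w (q n)) - g 0 (w 0)) \<longlonglongrightarrow> g ?\<sigma> (w ?\<sigma>) - g 0 (w 0)"
    by (intro tendsto_intros)
  then show "S \<longlonglongrightarrow> g ?\<sigma> (w ?\<sigma>) - g 0 (w 0)"
    by (rule Lim_transform_eventually)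
      (rule eventually_sequentiallyI[of 1], rule q(4)[symmetric], simp)
  show "\<bar>S n\<bar> \<le> 2 * C" if "\<And>s x. s \<in> {0..T} \<Longrightarrow> \<bar>g s x\<bar> \<le> C" "n > 0"
    unfolding q(4)[OF that(2)] using that(1)[OF q(1)[OF that(2)], of "w (q n)"] that(1)[of 0 "w 0"] T
    by auto
qed

text \<open>The increment of \<open>g\<close> in time is frozen at the right end point of each grid interval and its
  generator at the left end point; up to the exit time the two cancel in the limit.\<close>

lemma compensated_sum_tendsto_0:
  fixes g l :: "real \<Rightarrow> real \<Rightarrow> real"
  assumes w: "continuous_on {0..T} w" and U: "open U" and T: "0 < T"
    and deriv: "\<And>s x. s \<in> {0..T} \<Longrightarrow> ((\<lambda>s. g s x) has_real_derivative d s x) (at s)"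
    and l: "continuous_on ({0..T} \<times> UNIV) (\<lambda>(s, x). l s x)"
    and d_bound: "\<And>s x. s \<in> {0..T} \<Longrightarrow> \<bar>d s x\<bar> \<le> C" and l_bound: "\<And>s x. s \<in> {0..T} \<Longrightarrow> \<bar>l s x\<bar> \<le> C"
    and cancel: "\<And>s x. s \<in> {0..T} \<Longrightarrow> x \<in> U \<Longrightarrow> d s x + l s x = 0"
  defines "p \<equiv> \<lambda>n k. T * real k / real n"
  defines "V \<equiv> \<lambda>n. \<Sum>k<n. of_bool (\<forall>r\<in>{0..p n k}. w r \<in> U) *
            (g (p n (Suc k)) (w (p n (Suc k))) - g (p n k) (w (p n (Suc k)))
              + integral {p n k..p n (Suc k)} (\<lambda>r. l (p n k) (w r)))"
  shows "V \<longlonglongrightarrow> 0" "\<And>n. n > 0 \<Longrightarrow> \<bar>V n\<bar> \<le> 2 * C * T"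
proof -
  let ?\<sigma> = "exit_time U T w"
  define D where "D n k = g (p n (Suc k)) (w (p n (Suc k))) - g (p n k) (w (p n (Suc k)))
              + integral {p n k..p n (Suc k)} (\<lambda>r. l (p n k) (w r))" for n k
  have step: "p n (Suc k) = p n k + T / n" for n k
    by (simp add: p_def distrib_left add_divide_distrib)
  have in_T: "{p n k..p n (Suc k)} \<subseteq> {0..T}" "p n k < p n (Suc k)" if "k < n" for n k
  proof -
    have "real (Suc k) \<le> real n" using that by linarith
    then have "T * real (Suc k) \<le> T * real n" using T by (intro mult_left_mono) auto
    then have "T * real (Suc k) / real n \<le> T" "0 \<le> T * real k / real n" "0 < T / real n"
      using that T by (simp_all add: divide_le_eq del: of_nat_Suc)
    then show "{p n k..p n (Suc k)} \<subseteq> {0..T}" "p n k < p n (Suc k)"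
      using step[of n k] unfolding p_def by auto
  qed
  have l_cont: "continuous_on {p n k..p n (Suc k)} (\<lambda>r. l (p n k) (w r))" if "k < n" for n k
  proof -
    have "p n k \<in> {0..T}" using in_T[OF that] by auto
    then have "continuous_on {p n k..p n (Suc k)} (\<lambda>r. (\<lambda>(s, x). l s x) (p n k, w r))"
      using in_T(1)[OF that]
      by (intro continuous_on_compose2[OF l] continuous_intros continuous_on_subset[OF w]) auto
    then show ?thesis by simp
  qed
  \<comment> \<open>The mean value theorem writes the time increment as the integral of a constant,
    so that both parts of \<open>D n k\<close> stand under one integral and can cancel
    pointwise.\<close>
  have mvt: "\<exists>\<xi>\<in>{p n k..p n (Suc k)}. D n k = integral {p n k..p n (Suc k)}
      (\<lambda>r. l (p n k) (w r) + d \<xi> (w (p n (Suc k))))" if "k < n" for n k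
  proof -
    let ?y = "w (p n (Suc k))"
    have "\<exists>\<xi>>p n k. \<xi> < p n (Suc k) \<and> g (p n (Suc k)) ?y - g (p n k) ?y =
        (p n (Suc k) - p n k) * d \<xi> ?y"
      using in_T[OF that] by (intro MVT2 deriv) auto
    then obtain \<xi> where \<xi>: "p n k < \<xi>" "\<xi> < p n (Suc k)"
        "g (p n (Suc k)) ?y - g (p n k) ?y = (p n (Suc k) - p n k) * d \<xi> ?y" by auto
    have "integral {p n k..p n (Suc k)} (\<lambda>r. l (p n k) (w r) + d \<xi> ?y)
        = integral {p n k..p n (Suc k)} (\<lambda>r. l (p n k) (w r))
          + integral {p n k..p n (Suc k)} (\<lambda>r. d \<xi> ?y)"
      by (intro Henstock_Kurzweil_Integration.integral_add integrable_continuous_real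
            l_cont[OF that] continuous_intros)
    then have "D n k = integral {p n k..p n (Suc k)} (\<lambda>r. l (p n k) (w r) + d \<xi> ?y)"
      unfolding D_def using \<xi> by simp
    then show ?thesis using \<xi> by auto
  qed
  have D_le: "\<bar>D n k\<bar> \<le> B * (T / n)"
    if kn: "k < n" and B: "\<And>r \<xi>. r \<in> {p n k..p n (Suc k)} \<Longrightarrow> \<xi> \<in> {p n k..p n (Suc k)} \<Longrightarrow>
        \<bar>l (p n k) (w r) + d \<xi> (w (p n (Suc k)))\<bar> \<le> B" for n k B
  proof -
    obtain \<xi> where \<xi>: "\<xi> \<in> {p n k..p n (Suc k)}" "D n k = integral {p n k..p n (Suc k)}
        (\<lambda>r. l (p n k) (w r) + d \<xi> (w (p n (Suc k))))" using mvt[OF kn] by auto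
    have "\<bar>D n k\<bar> \<le> B * (p n (Suc k) - p n k)"
      unfolding \<xi>(2) real_norm_def[symmetric] using B \<xi>(1) in_T[OF kn]
      by (intro integral_bound continuous_intros l_cont kn) auto
    then show ?thesis by (simp add: step)
  qed
  have D_bound: "\<bar>D n k\<bar> \<le> 2 * C * (T / n)" if "k < n" for n k
  proof (rule D_le[OF that])
    fix r \<xi> assume *: "r \<in> {p n k..p n (Suc k)}" "\<xi> \<in> {p n k..p n (Suc k)}"
    have "p n k \<in> {0..T}" "\<xi> \<in> {0..T}" using in_T[OF that] *(2) by auto
    then show "\<bar>l (p n k) (w r) + d \<xi> (w (p n (Suc k)))\<bar> \<le> 2 * C"
      using d_bound[of \<xi> "w (p n (Suc k))"] l_bound[of "p n k" "w r"] by linarith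
  qed
  have C: "0 \<le> C" using d_bound[of 0 0] T by simp
  have sum: "\<exists>j\<le>n. (\<forall>k<j. p n k < ?\<sigma>) \<and> V n = (\<Sum>k<j. D n k)" if n: "n > 0" for n
  proof -
    have "p n k = T * real k / real n" for k by (simp add: p_def)
    note grid_exit[OF w U T n this]
    then obtain j where j: "j \<le> n" "?\<sigma> \<le> p n j" "p n j \<le> ?\<sigma> + T / n"
      "\<forall>k<j. p n k < ?\<sigma>"
      "\<forall>g :: nat \<Rightarrow> real. (\<Sum>k<n. of_bool (\<forall>r\<in>{0..p n k}. w r \<in> U) * g k) = (\<Sum>k<j. g k)"
      by (elim exE conjE)
    have "V n = (\<Sum>k<j. D n k)" unfolding V_def D_def[symmetric] by (rule j(5)[rule_format])
    then show ?thesis using j(1,4) by auto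
  qed
  show "\<bar>V n\<bar> \<le> 2 * C * T" if n: "n > 0" for n
  proof -
    obtain j where j: "j \<le> n" "V n = (\<Sum>k<j. D n k)" using sum[OF n] by auto
    have "\<bar>V n\<bar> \<le> (\<Sum>k<j. 2 * C * (T / n))"
      unfolding j(2) using j(1) by (intro order_trans[OF sum_abs] sum_mono D_bound) auto
    also have "\<dots> = 2 * C * T * (real j / real n)" by simp
    also have "\<dots> \<le> 2 * C * T * 1"
      using j(1) n C T by (intro mult_left_mono) (auto simp: divide_le_eq)
    finally show ?thesis by simp
  qed
  show "V \<longlonglongrightarrow> 0"
  proof (rule LIMSEQ_I)
    fix e :: real assume e: "0 < e"
    define \<eta> where "\<eta> = e / (2 * T)"
    have \<eta>: "0 < \<eta>" using e T by (simp add: \<eta>_def)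
    \<comment> \<open>Uniform continuity is needed in the two times separately: \<open>l\<close> is
      evaluated at a frozen time and at the position of the path at another time.\<close>
    have "continuous_on ({0..T} \<times> {0..T}) (\<lambda>z. (\<lambda>(s, x). l s x) (fst z, w (snd z)))"
      by (intro continuous_on_compose2[OF l] continuous_on_Pair continuous_on_fst
          continuous_on_compose2[OF w continuous_on_snd] continuous_on_id) auto
    then have "uniformly_continuous_on ({0..T} \<times> {0..T}) (\<lambda>z. l (fst z) (w (snd z)))"
      by (intro compact_uniformly_continuous compact_Times) auto
    then obtain \<delta> where \<delta>: "0 < \<delta>" "\<And>z z'. z \<in> {0..T} \<times> {0..T} \<Longrightarrow> z' \<in> {0..T} \<times> {0..T} \<Longrightarrow>
        dist z' z < \<delta> \<Longrightarrow> dist (l (fst z') (w (snd z'))) (l (fst z) (w (snd z))) < \<eta>"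
      unfolding uniformly_continuous_on_def using \<eta> by metis
    \<comment> \<open>\<open>K / n\<close> will bound the term of the last grid interval before the
      rounded exit time: its right end point may lie outside \<open>U\<close>, so there is no
      cancellation and only \<open>D_bound\<close> applies.\<close>
    define K where "K = 2 * C * T + 1"
    have K: "0 < K" using C T by (simp add: K_def add_nonneg_pos)
    have "eventually (\<lambda>n. K / real n < e / 2) sequentially"
      using e by (intro order_tendstoD[OF lim_const_over_n]) auto
    moreover have "eventually (\<lambda>n. (2 * T) / real n < \<delta>) sequentially"
      using \<delta>(1) by (intro order_tendstoD[OF lim_const_over_n]) auto
    moreover have "eventually (\<lambda>n. n > 0) sequentially" by (rule eventually_gt_at_top)
    ultimately have "eventually (\<lambda>n. norm (V n - 0) < e) sequentially"
    proof eventually_elim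
      case (elim n)
      obtain j where j: "j \<le> n" "\<And>k. k < j \<Longrightarrow> p n k < ?\<sigma>" "V n = (\<Sum>k<j. D n k)"
        using sum[OF elim(3)] by auto
      \<comment> \<open>For \<open>Suc k < j\<close> the right end point precedes the exit time, so
        \<open>cancel\<close> replaces \<open>d\<close> by \<open>- l\<close> there, and a
        difference of two nearby values of \<open>l\<close> remains.\<close>
      have small: "\<bar>D n k\<bar> \<le> \<eta> * (T / n)" if k: "Suc k < j" for k
      proof (rule D_le)
        show kn: "k < n" using k j(1) by simp
        fix r \<xi> assume *: "r \<in> {p n k..p n (Suc k)}" "\<xi> \<in> {p n k..p n (Suc k)}"
        let ?y = "w (p n (Suc k))"
        have y: "?y \<in> U" using before_exit_time[OF _ j(2)[OF k]] T by (simp add: p_def)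
        have \<xi>: "\<xi> \<in> {0..T}" using *(2) in_T[OF kn] by auto
        have dd: "\<bar>l (p n k) (w r) + d \<xi> ?y\<bar> = dist (l (p n k) (w r)) (l \<xi> ?y)"
          using cancel[OF \<xi> y] by (simp add: dist_real_def)
        have "dist (p n k, r) (\<xi>, p n (Suc k)) \<le> \<bar>p n k - \<xi>\<bar> + \<bar>r - p n (Suc k)\<bar>"
          unfolding dist_prod_def by (simp add: dist_real_def sqrt_sum_squares_le_sum_abs)
        also have "\<dots> \<le> 2 * T / n" using * step[of n k] by auto
        finally have "dist (p n k, r) (\<xi>, p n (Suc k)) < \<delta>" using elim(2) by linarith
        moreover have "(\<xi>, p n (Suc k)) \<in> {0..T} \<times> {0..T}" "(p n k, r) \<in> {0..T} \<times> {0..T}"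
          using in_T[OF kn] * by auto
        ultimately have "dist (l (p n k) (w r)) (l \<xi> ?y) < \<eta>"
          using \<delta>(2)[of "(\<xi>, p n (Suc k))" "(p n k, r)"] by simp
        then show "\<bar>l (p n k) (w r) + d \<xi> ?y\<bar> \<le> \<eta>" unfolding dd by simp
      qed
      have "\<bar>V n\<bar> \<le> \<eta> * T + K / n"
      proof (cases j)
        case 0
        then show ?thesis using j(3) \<eta> T K by simp
      next
        case (Suc i)
        have "\<bar>V n\<bar> \<le> (\<Sum>k<i. \<bar>D n k\<bar>) + \<bar>D n i\<bar>"
          unfolding j(3) Suc by (simp add: order_trans[OF abs_triangle_ineq] sum_abs)
        also have "\<dots> \<le> (\<Sum>k<i. \<eta> * (T / n)) + 2 * C * (T / n)"
          using j(1) Suc by (intro add_mono sum_mono small D_bound) auto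
        also have "\<dots> \<le> \<eta> * T * (real i / real n) + K / n"
          using elim(3) by (simp add: K_def divide_simps)
        also have "\<dots> \<le> \<eta> * T * 1 + K / n"
          using j(1) Suc elim(3) \<eta> T by (intro add_right_mono mult_left_mono) (auto simp: divide_le_eq)
        finally show ?thesis by simp
      qed
      also have "\<eta> * T = e / 2" using T by (simp add: \<eta>_def)
      finally show ?case using elim(1) unfolding diff_0_right real_norm_def by linarith
    qed
    then show "\<exists>no. \<forall>n\<ge>no. norm (V n - 0) < e" by (simp add: eventually_sequentially)
  qed
qed

subsection \<open>Stopping space-time harmonic functions\<close>

context bessel begin

text \<open>Optional stopping for a space-time function. On each grid interval the spatial
  increment, with time frozen, is exchanged for the integral of the generator by
  \<open>martingale_increment\<close>; hence \<open>S n\<close> and \<open>V n\<close> have the same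
  expectation. The first sums converge to the stopped increment, the second to 0, both
  boundedly.\<close>

lemma expectation_stopped_test_function:
  assumes U: "open U" and T: "0 < T"
    and test: "\<And>s. s \<in> {0..T} \<Longrightarrow> test_function (g s)"
    and g: "continuous_on ({0..T} \<times> UNIV) (\<lambda>(s, x). g s x)"
    and deriv: "\<And>s x. s \<in> {0..T} \<Longrightarrow> ((\<lambda>s. g s x) has_real_derivative d s x) (at s)"
    and l: "continuous_on ({0..T} \<times> UNIV) (\<lambda>(s, x). bessel_generator \<nu> (g s) x)"
    and bounds: "\<And>s x. s \<in> {0..T} \<Longrightarrow> \<bar>g s x\<bar> \<le> C" "\<And>s x. s \<in> {0..T} \<Longrightarrow> \<bar>d s x\<bar> \<le> C"
      "\<And>s x. s \<in> {0..T} \<Longrightarrow> \<bar>bessel_generator \<nu> (g s) x\<bar> \<le> C"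
    and cancel: "\<And>s x. s \<in> {0..T} \<Longrightarrow> x \<in> U \<Longrightarrow> d s x + bessel_generator \<nu> (g s) x = 0"
  shows "(\<lambda>w. g (exit_time U T w) (w (exit_time U T w))) \<in> borel_measurable P"
    and "expectation (\<lambda>w. g (exit_time U T w) (w (exit_time U T w))) = g 0 a"
proof -
  define p where "p = (\<lambda>(n::nat) k. T * real k / real n)"
  define A where "A n k = {w \<in> space path_space. \<forall>r\<in>{0..p n k}. w r \<in> U}" for n k
  define L where "L s = bessel_generator \<nu> (g s)" for s
  define S where "S n w = (\<Sum>k<n. of_bool (\<forall>r\<in>{0..p n k}. w r \<in> U) *
            (g (p n (Suc k)) (w (p n (Suc k))) - g (p n k) (w (p n k))))" for n w
  define V where "V n w = (\<Sum>k<n. of_bool (\<forall>r\<in>{0..p n k}. w r \<in> U) *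
            (g (p n (Suc k)) (w (p n (Suc k))) - g (p n k) (w (p n (Suc k)))
              + integral {p n k..p n (Suc k)} (\<lambda>r. L (p n k) (w r))))" for n w
  let ?\<sigma> = "exit_time U T"
  have S_lim: "(\<lambda>n. S n w) \<longlonglongrightarrow> g (?\<sigma> w) (w (?\<sigma> w)) - g 0 (w 0)"
    and S_bound: "\<bar>S n w\<bar> \<le> 2 * C" and V_lim: "(\<lambda>n. V n w) \<longlonglongrightarrow> 0"
    and V_bound: "\<bar>V n w\<bar> \<le> 2 * C * T" if "w \<in> space P" for n w
  proof -
    have w: "continuous_on {0..T} w" using path_continuous that by simp
    have C: "0 \<le> C" using bounds(1)[of 0 0] T by simp
    show "(\<lambda>n. S n w) \<longlonglongrightarrow> g (?\<sigma> w) (w (?\<sigma> w)) - g 0 (w 0)"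
      unfolding S_def p_def by (rule stopped_sum_tendsto(1)[OF w U T g])
    show "\<bar>S n w\<bar> \<le> 2 * C"
    proof (cases "n = 0")
      case False
      then show ?thesis
        unfolding S_def p_def by (intro stopped_sum_tendsto(2)[OF w U T g] bounds) auto
    qed (use C in \<open>simp add: S_def\<close>)
    show "(\<lambda>n. V n w) \<longlonglongrightarrow> 0"
      unfolding V_def p_def L_def by (rule compensated_sum_tendsto_0(1)[OF w U T deriv l bounds(2,3) cancel])
    show "\<bar>V n w\<bar> \<le> 2 * C * T"
    proof (cases "n = 0")
      case False
      then show ?thesis
        unfolding V_def p_def L_def
        by (intro compensated_sum_tendsto_0(2)[OF w U T deriv l bounds(2,3) cancel]) auto
    qed (use C T in \<open>simp add: V_def\<close>)
  qed
  have pk: "p n k \<in> {0..T}" "p n (Suc k) \<in> {0..T}" "p n k \<le> p n (Suc k)" if "k < n" for n k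
  proof -
    have "real (Suc k) \<le> real n" using that by linarith
    then have "T * real (Suc k) \<le> T * real n" "T * real k \<le> T * real (Suc k)"
      using T by (auto intro!: mult_left_mono)
    then show "p n k \<in> {0..T}" "p n (Suc k) \<in> {0..T}" "p n k \<le> p n (Suc k)"
      using that T unfolding p_def
      by (auto simp: divide_le_eq divide_right_mono simp del: of_nat_Suc)
  qed
  have A: "A n k \<in> sets (path_filtration (p n k))" if "k < n" for n k
    unfolding A_def using pk[OF that] U by (intro stays_open_measurable) auto
  have L_cont: "continuous_on UNIV (L s)" if "s \<in> {0..T}" for s
  proof -
    have "continuous_on UNIV (\<lambda>x. (\<lambda>(s, x). bessel_generator \<nu> (g s) x) (s, x))"
      using that by (intro continuous_on_compose2[OF l] continuous_intros) auto
    then show ?thesis unfolding L_def by simp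
  qed
  have g_int: "integrable P (\<lambda>w. g s (w t))" if "s \<in> {0..T}" "0 \<le> t" for s t
    using martingale_increment(1)[OF test[OF that(1)] L_cont[OF that(1), unfolded L_def], of t t "{}"] that
    by simp
  have ind: "integrable P (\<lambda>w. of_bool (\<forall>r\<in>{0..p n k}. w r \<in> U) * f w)
      \<and> (\<integral>w. of_bool (\<forall>r\<in>{0..p n k}. w r \<in> U) * f w \<partial>P) = (\<integral>w. indicator (A n k) w * f w \<partial>P)"
    if "integrable P f" "k < n" for f :: "(real \<Rightarrow> real) \<Rightarrow> real" and n k
  proof -
    have eq: "of_bool (\<forall>r\<in>{0..p n k}. w r \<in> U) * f w = indicator (A n k) w * f w" if "w \<in> space P" for w
      using that by (simp add: A_def indicator_def)
    have "integrable P (\<lambda>w. indicator (A n k) w * f w)"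
      using integrable_real_mult_indicator[OF sets_filtration_P[OF A[OF that(2)]] that(1)]
      by (simp add: mult.commute)
    moreover have "integrable P (\<lambda>w. of_bool (\<forall>r\<in>{0..p n k}. w r \<in> U) * f w)
        \<longleftrightarrow> integrable P (\<lambda>w. indicator (A n k) w * f w)"
      by (intro Bochner_Integration.integrable_cong refl eq)
    moreover have "(\<integral>w. of_bool (\<forall>r\<in>{0..p n k}. w r \<in> U) * f w \<partial>P)
        = (\<integral>w. indicator (A n k) w * f w \<partial>P)"
      by (intro Bochner_Integration.integral_cong refl eq)
    ultimately show ?thesis by simp
  qed
  have int_l: "integrable P (\<lambda>w. integral {p n k..p n (Suc k)} (\<lambda>r. L (p n k) (w r)))" if "k < n" for n k
    unfolding L_def using pk[OF that] A[OF that]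
    by (intro martingale_increment(2) test L_cont[unfolded L_def]) auto
  have S_int: "integrable P (S n)" and V_int: "integrable P (V n)" and SV: "expectation (S n) = expectation (V n)" for n
  proof -
    let ?G1 = "\<lambda>k w. g (p n (Suc k)) (w (p n (Suc k)))"
    \<comment> \<open>The intermediate value: the path has moved, the time argument has not.
      \<open>?G1 - ?G2\<close> is the time increment and \<open>?G2 - ?G3\<close> the spatial
      one.\<close>
    let ?G2 = "\<lambda>k w. g (p n k) (w (p n (Suc k)))"
    let ?G3 = "\<lambda>k w. g (p n k) (w (p n k))"
    let ?I = "\<lambda>k w. integral {p n k..p n (Suc k)} (\<lambda>r. L (p n k) (w r))"
    have G: "integrable P (?G1 k)" "integrable P (?G2 k)" "integrable P (?G3 k)" if "k < n" for k
      using pk[OF that] by (auto intro!: g_int)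
    have 1: "integrable P (\<lambda>w. ?G1 k w - ?G3 k w)" "integrable P (\<lambda>w. ?G1 k w - ?G2 k w + ?I k w)"
      "integrable P (\<lambda>w. ?G1 k w - ?G2 k w)" "integrable P (\<lambda>w. ?G2 k w - ?G3 k w)" if "k < n" for k
      using G[OF that] int_l[OF that] by auto
    show "integrable P (S n)" "integrable P (V n)"
      unfolding S_def V_def
      by (intro Bochner_Integration.integrable_sum ind[THEN conjunct1] 1; simp)+
    have "expectation (S n) = (\<Sum>k<n. \<integral>w. of_bool (\<forall>r\<in>{0..p n k}. w r \<in> U) * (?G1 k w - ?G3 k w) \<partial>P)"
      unfolding S_def by (intro Bochner_Integration.integral_sum ind[THEN conjunct1] 1) auto
    also have "\<dots> = (\<Sum>k<n. \<integral>w. indicator (A n k) w * (?G1 k w - ?G3 k w) \<partial>P)"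
      by (intro sum.cong refl ind[THEN conjunct2] 1) auto
    also have "\<dots> = (\<Sum>k<n. \<integral>w. indicator (A n k) w * (?G1 k w - ?G2 k w + ?I k w) \<partial>P)"
    proof (intro sum.cong refl)
      fix k assume "k \<in> {..<n}"
      then have k: "k < n" by simp
      have ii: "integrable P (\<lambda>w. indicator (A n k) w * f w)" if "integrable P f" for f :: "_ \<Rightarrow> real"
        using integrable_real_mult_indicator[OF sets_filtration_P[OF A[OF k]] that]
        by (simp add: mult.commute)
      have "(\<integral>w. indicator (A n k) w * (?G1 k w - ?G3 k w) \<partial>P)
          = (\<integral>w. indicator (A n k) w * (?G1 k w - ?G2 k w) + indicator (A n k) w * (?G2 k w - ?G3 k w) \<partial>P)"
        by (intro Bochner_Integration.integral_cong refl) (simp add: algebra_simps)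
      also have "\<dots> = (\<integral>w. indicator (A n k) w * (?G1 k w - ?G2 k w) \<partial>P)
          + (\<integral>w. indicator (A n k) w * (?G2 k w - ?G3 k w) \<partial>P)"
        using 1[OF k] by (intro Bochner_Integration.integral_add ii)
      also have "(\<integral>w. indicator (A n k) w * (?G2 k w - ?G3 k w) \<partial>P) = (\<integral>w. indicator (A n k) w * ?I k w \<partial>P)"
        unfolding L_def using pk[OF k] A[OF k]
        by (intro martingale_increment(3) test L_cont[unfolded L_def]) auto
      also have "(\<integral>w. indicator (A n k) w * (?G1 k w - ?G2 k w) \<partial>P) + (\<integral>w. indicator (A n k) w * ?I k w \<partial>P)
          = (\<integral>w. indicator (A n k) w * (?G1 k w - ?G2 k w) + indicator (A n k) w * ?I k w \<partial>P)"
        using 1[OF k] int_l[OF k] by (intro Bochner_Integration.integral_add[symmetric] ii)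
      also have "\<dots> = (\<integral>w. indicator (A n k) w * (?G1 k w - ?G2 k w + ?I k w) \<partial>P)"
        by (intro Bochner_Integration.integral_cong refl) (simp add: algebra_simps)
      finally show "(\<integral>w. indicator (A n k) w * (?G1 k w - ?G3 k w) \<partial>P)
        = (\<integral>w. indicator (A n k) w * (?G1 k w - ?G2 k w + ?I k w) \<partial>P)" .
    qed
    also have "\<dots> = (\<Sum>k<n. \<integral>w. of_bool (\<forall>r\<in>{0..p n k}. w r \<in> U) * (?G1 k w - ?G2 k w + ?I k w) \<partial>P)"
      by (intro sum.cong refl ind[THEN conjunct2, symmetric] 1) auto
    also have "\<dots> = expectation (V n)"
      unfolding V_def by (intro Bochner_Integration.integral_sum[symmetric] ind[THEN conjunct1] 1) auto
    finally show "expectation (S n) = expectation (V n)" .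
  qed
  let ?Z = "\<lambda>w. g (?\<sigma> w) (w (?\<sigma> w))"
  have g0: "integrable P (\<lambda>w. g 0 (w 0))" using T by (intro g_int) auto
  have Zm: "(\<lambda>w. ?Z w - g 0 (w 0)) \<in> borel_measurable P"
    by (rule borel_measurable_LIMSEQ_real[OF S_lim borel_measurable_integrable[OF S_int]])
  then have "(\<lambda>w. (?Z w - g 0 (w 0)) + g 0 (w 0)) \<in> borel_measurable P"
    by (intro borel_measurable_add borel_measurable_integrable[OF g0])
  then show Z: "?Z \<in> borel_measurable P" by simp
  have "(\<lambda>n. expectation (S n)) \<longlonglongrightarrow> expectation (\<lambda>w. ?Z w - g 0 (w 0))"
    using S_lim S_bound
    by (intro integral_dominated_convergence[where w="\<lambda>_. 2 * C"] Zm borel_measurable_integrable[OF S_int])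
      (auto intro!: AE_I2)
  moreover have "(\<lambda>n. expectation (V n)) \<longlonglongrightarrow> expectation (\<lambda>w. 0)"
    using V_lim V_bound
    by (intro integral_dominated_convergence[where w="\<lambda>_. 2 * C * T"] borel_measurable_integrable[OF V_int])
      (auto intro!: AE_I2)
  ultimately have *: "expectation (\<lambda>w. ?Z w - g 0 (w 0)) = 0"
    unfolding SV using LIMSEQ_unique by fastforce
  have "?\<sigma> w \<in> {0..T}" for w using exit_time_bounds[of T U w] T by auto
  then have "integrable P ?Z"
    using bounds(1) by (intro integrable_const_bound[where B=C] Z) auto
  then have "expectation ?Z = expectation (\<lambda>w. g 0 (w 0))" using * g0 by simp
  also have "\<dots> = expectation (\<lambda>w. g 0 a)"
    using start by (intro integral_cong_AE borel_measurable_integrable[OF g0]) auto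
  finally show "expectation ?Z = g 0 a" using prob_space by simp
qed

end

section \<open>Cutoff in space and stopping in a bounded interval\<close>

lemma has_real_derivative_positive_part_power:
  "((\<lambda>y::real. max 0 y ^ Suc (Suc n)) has_real_derivative real (n + 2) * max 0 y ^ Suc n) (at y)"
proof -
  consider "y < 0" | "y = 0" | "0 < y" by linarith
  then show ?thesis
  proof cases
    case 1
    have "((\<lambda>y::real. 0) has_real_derivative 0) (at y)" by simp
    then have "((\<lambda>y::real. max 0 y ^ Suc (Suc n)) has_real_derivative 0) (at y)"
      by (rule has_field_derivative_transform_within_open[where S="{..<0}"]) (use 1 in auto)
    then show ?thesis using 1 by simp
  next
    case 2
    have "((\<lambda>h::real. max 0 h ^ Suc n) \<longlongrightarrow> max 0 0 ^ Suc n) (at 0)"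
      by (intro tendsto_intros)
    moreover have "eventually (\<lambda>h::real. max 0 h ^ Suc n =
        (max 0 (0 + h) ^ Suc (Suc n) - max 0 0 ^ Suc (Suc n)) / h) (at 0)"
      by (auto simp: eventually_at_filter max_def)
    ultimately have "((\<lambda>h::real. (max 0 (0 + h) ^ Suc (Suc n) - max 0 0 ^ Suc (Suc n)) / h)
        \<longlongrightarrow> max 0 0 ^ Suc n) (at 0)"
      by (rule Lim_transform_eventually)
    then show ?thesis using 2 by (simp add: DERIV_def)
  next
    case 3
    have "((\<lambda>y::real. y ^ Suc (Suc n)) has_real_derivative real (n + 2) * y ^ Suc n) (at y)"
      using DERIV_pow[of "Suc (Suc n)" y] by (simp only: diff_Suc_Suc diff_zero add_2_eq_Suc')
    then have "((\<lambda>y::real. max 0 y ^ Suc (Suc n)) has_real_derivative real (n + 2) * y ^ Suc n) (at y)"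
      by (rule has_field_derivative_transform_within_open[where S="{0<..}"]) (use 3 in auto)
    then show ?thesis using 3 by simp
  qed
qed

text \<open>With \<open>q y = (max 0 y)\<^sup>3\<close>, which is \<open>C\<^sup>2\<close>, the function \<open>1 - q (1 - q y)\<close> is a \<open>C\<^sup>2\<close> step
  from \<open>0\<close> on \<open>y \<le> 0\<close> to \<open>1\<close> on \<open>y \<ge> 1\<close>; the argument \<open>y\<close> is a concave quadratic.\<close>

lemma cutoff_exists:
  fixes b N :: real
  assumes "0 < b" "b < N"
  shows "\<exists>(\<phi> :: real \<Rightarrow> real) \<phi>1 \<phi>2.
    (\<forall>x. (\<phi> has_real_derivative \<phi>1 x) (at x)) \<and> (\<forall>x. (\<phi>1 has_real_derivative \<phi>2 x) (at x)) \<and>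
    continuous_on UNIV \<phi>2 \<and>
    (\<forall>x. x \<le> b / 2 \<or> 2 * N \<le> x \<longrightarrow> \<phi> x = 0 \<and> \<phi>1 x = 0 \<and> \<phi>2 x = 0) \<and>
    (\<forall>x\<in>{b..N}. \<phi> x = 1 \<and> \<phi>1 x = 0 \<and> \<phi>2 x = 0)"
proof -
  define q q' q'' :: "real \<Rightarrow> real"
    where "q y = max 0 y ^ 3" and "q' y = 3 * max 0 y ^ 2" and "q'' y = 6 * max 0 y" for y
  have q: "(q has_real_derivative q' y) (at y)" "(q' has_real_derivative q'' y) (at y)" for y
    using has_real_derivative_positive_part_power[of 1 y]
      DERIV_cmult[OF has_real_derivative_positive_part_power[of 0 y], of 3]
    unfolding q_def q'_def q''_def by (simp_all add: numeral_eq_Suc)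
  \<comment> \<open>\<open>c\<close> is the lower bound of \<open>(x - b / 2) * (2 * N - x)\<close>
    on \<open>{b..N}\<close>, where the factors are at least \<open>b / 2\<close> and
    \<open>N\<close>; dividing by it makes \<open>y\<close> at least 1 there. Outside
    \<open>{b/2..2 * N}\<close> the product is negative.\<close>
  define c where "c = b * N / 2"
  have c: "0 < c" using assms by (simp add: c_def)
  define y y' where "y x = (x - b / 2) * (2 * N - x) / c" and "y' x = (2 * N + b / 2 - 2 * x) / c" for x
  have y: "(y has_real_derivative y' x) (at x)" "(y' has_real_derivative - 2 / c) (at x)" for x
    using c unfolding y_def y'_def by (auto intro!: derivative_eq_intros simp: field_simps)
  define \<phi> \<phi>1 \<phi>2 where "\<phi> x = 1 - q (1 - q (y x))" and "\<phi>1 x = q' (1 - q (y x)) * (q' (y x) * y' x)"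
    and "\<phi>2 x = - q'' (1 - q (y x)) * (q' (y x) * y' x) * (q' (y x) * y' x)
      + q' (1 - q (y x)) * (q'' (y x) * y' x * y' x + q' (y x) * (- 2 / c))" for x
  have qy: "((\<lambda>x. q (y x)) has_real_derivative q' (y x) * y' x) (at x)"
    "((\<lambda>x. q' (y x)) has_real_derivative q'' (y x) * y' x) (at x)" for x
    by (intro DERIV_chain2[OF q(1) y(1)] DERIV_chain2[OF q(2) y(1)])+
  have q1: "((\<lambda>x. 1 - q (y x)) has_real_derivative - (q' (y x) * y' x)) (at x)" for x
    using DERIV_diff[OF DERIV_const qy(1)[of x], of 1] by simp
  have d1: "(\<phi> has_real_derivative \<phi>1 x) (at x)" for x
    using DERIV_diff[OF DERIV_const DERIV_chain2[OF q(1) q1[of x]], of 1] unfolding \<phi>_def \<phi>1_def by simp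
  have d2: "(\<phi>1 has_real_derivative \<phi>2 x) (at x)" for x
    unfolding \<phi>1_def \<phi>2_def
    by (rule DERIV_cong[OF DERIV_mult[OF DERIV_chain2[OF q(2) q1[of x]] DERIV_mult[OF qy(2)[of x] y(2)[of x]]]])
      (simp add: algebra_simps)
  have cont: "continuous_on UNIV \<phi>2"
    unfolding \<phi>2_def q_def q'_def q''_def y_def y'_def using c by (intro continuous_intros) auto
  have out: "\<phi> x = 0 \<and> \<phi>1 x = 0 \<and> \<phi>2 x = 0" if "x \<le> b / 2 \<or> 2 * N \<le> x" for x
  proof -
    have "(x - b / 2) * (2 * N - x) \<le> 0" using that assms by (auto intro: mult_nonpos_nonneg mult_nonneg_nonpos)
    then have "y x \<le> 0" using c by (simp add: y_def divide_le_0_iff)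
    then show ?thesis unfolding \<phi>_def \<phi>1_def \<phi>2_def q_def q'_def q''_def by simp
  qed
  have in1: "\<phi> x = 1 \<and> \<phi>1 x = 0 \<and> \<phi>2 x = 0" if "x \<in> {b..N}" for x
  proof -
    have "b / 2 * N \<le> (x - b / 2) * (2 * N - x)" using that assms by (intro mult_mono) auto
    then have "1 \<le> y x" using c by (simp add: y_def c_def)
    then have "1 \<le> q (y x)" by (simp add: q_def)
    then show ?thesis unfolding \<phi>_def \<phi>1_def \<phi>2_def by (simp add: q_def[of "1 - _"] q'_def[of "1 - _"] q''_def[of "1 - _"])
  qed
  show ?thesis using d1 d2 cont out in1 by (intro exI[of _ \<phi>] exI[of _ \<phi>1] exI[of _ \<phi>2]) blast
qed

text \<open>Used to pass the point 0, where the drift coefficient is singular. The two closed pieces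
  overlap in \<open>{\<beta> / 2..\<beta>}\<close>, and on the left one the function
  vanishes.\<close>

lemma continuous_on_extend_zero:
  fixes F :: "real \<Rightarrow> real \<Rightarrow> real"
  assumes F: "continuous_on ({0..T} \<times> {0<..}) (\<lambda>(s, x). F s x)" and "0 < \<beta>"
    and zero: "\<And>s x. s \<in> {0..T} \<Longrightarrow> x \<le> \<beta> \<Longrightarrow> F s x = 0"
  shows "continuous_on ({0..T} \<times> UNIV) (\<lambda>(s, x). F s x)"
proof -
  have eq: "{0..T} \<times> (UNIV :: real set) = {0..T} \<times> {\<beta> / 2..} \<union> {0..T} \<times> {..\<beta>}"
    using \<open>0 < \<beta>\<close> by auto
  show ?thesis
    unfolding eq
  proof (rule continuous_on_closed_Un)
    show "continuous_on ({0..T} \<times> {\<beta> / 2..}) (\<lambda>(s, x). F s x)"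
      by (rule continuous_on_subset[OF F]) (use \<open>0 < \<beta>\<close> in auto)
    have "continuous_on ({0..T} \<times> {..\<beta>}) (\<lambda>_. 0 :: real)" by simp
    then show "continuous_on ({0..T} \<times> {..\<beta>}) (\<lambda>(s, x). F s x)"
      by (rule continuous_on_eq) (use zero in auto)
  qed (auto intro: closed_Times)
qed

lemma bounded_of_zero_outside:
  fixes F :: "real \<Rightarrow> real \<Rightarrow> real"
  assumes F: "continuous_on ({0..T} \<times> UNIV) (\<lambda>(s, x). F s x)"
    and zero: "\<And>s x. s \<in> {0..T} \<Longrightarrow> x \<le> \<beta> \<or> M \<le> x \<Longrightarrow> F s x = 0"
  shows "\<exists>C. \<forall>s\<in>{0..T}. \<forall>x. \<bar>F s x\<bar> \<le> C"
proof -
  have "compact ((\<lambda>(s, x). F s x) ` ({0..T} \<times> {\<beta>..M}))"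
    by (intro compact_continuous_image continuous_on_subset[OF F] compact_Times) auto
  then obtain C where C: "\<forall>z\<in>(\<lambda>(s, x). F s x) ` ({0..T} \<times> {\<beta>..M}). norm z \<le> C"
    using compact_imp_bounded bounded_iff by blast
  have "\<bar>F s x\<bar> \<le> \<bar>C\<bar>" if "s \<in> {0..T}" for s x
  proof (cases "x \<le> \<beta> \<or> M \<le> x")
    case False
    then have "F s x \<in> (\<lambda>(s, x). F s x) ` ({0..T} \<times> {\<beta>..M})" using that by force
    then show ?thesis using C by force
  qed (use zero that in auto)
  then show ?thesis by blast
qed

lemma exit_position_in_closure:
  assumes w: "continuous_on {0..T} w" and T: "0 < T" and "w 0 \<in> U"
  shows "w (exit_time U T w) \<in> closure U"
proof (cases "exit_time U T w = 0")
  case True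
  then show ?thesis using assms closure_subset by auto
next
  case False
  let ?\<sigma> = "exit_time U T w"
  have \<sigma>: "0 < ?\<sigma>" "?\<sigma> \<le> T" using False exit_time_bounds[of T U w] T by auto
  have cl: "closure {0..<?\<sigma>} = {0..?\<sigma>}" using \<sigma> by (simp add: closure_atLeastLessThan)
  have "w ` closure {0..<?\<sigma>} \<subseteq> closure U"
  proof (rule image_closure_subset)
    show "continuous_on (closure {0..<?\<sigma>}) w" unfolding cl using \<sigma> by (intro continuous_on_subset[OF w]) auto
    have "w ` {0..<?\<sigma>} \<subseteq> U" using before_exit_time[of _ U T w] T by auto
    then show "w ` {0..<?\<sigma>} \<subseteq> closure U" using closure_subset by blast
  qed simp
  then show ?thesis unfolding cl using \<sigma> by auto
qed

context bessel begin

text \<open>Evaluating a path at its own exit time is not a coordinate map. Taking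
  \<open>g s x = x\<close> in \<open>stopped_sum_tendsto\<close> exhibits it as a limit of finite
  sums of coordinates weighted by measurable events.\<close>

lemma exit_position_measurable:
  assumes U: "open U" and T: "0 < T"
  shows "(\<lambda>w. w (exit_time U T w)) \<in> borel_measurable P"
proof -
  define p where "p = (\<lambda>(n::nat) k. T * real k / real n)"
  define S where "S n w = (\<Sum>k<n. of_bool (\<forall>r\<in>{0..p n k}. w r \<in> U) * (w (p n (Suc k)) - w (p n k)))"
    for n and w :: "real \<Rightarrow> real"
  have lim: "(\<lambda>n. S n w) \<longlonglongrightarrow> w (exit_time U T w) - w 0" if "w \<in> space P" for w
    unfolding S_def p_def
    using that by (intro stopped_sum_tendsto(1)[OF path_continuous U T, of w "\<lambda>s x. x"])
      (auto simp: case_prod_unfold intro!: continuous_intros)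
  have meas: "S n \<in> borel_measurable P" for n
    unfolding S_def
  proof (rule borel_measurable_sum)
    fix k
    have "{w \<in> space P. \<forall>r\<in>{0..p n k}. w r \<in> U} \<in> sets P"
      unfolding space_P by (rule sets_filtration_P[OF stays_open_measurable[OF order_refl order_refl U]])
    then have "(\<lambda>w. of_bool (\<forall>r\<in>{0..p n k}. w r \<in> U) :: real) \<in> borel_measurable P"
      unfolding of_bool_def by (intro measurable_If borel_measurable_const)
    moreover have "(\<lambda>w. w (p n (Suc k)) - w (p n k)) \<in> borel_measurable P"
      using T by (intro borel_measurable_diff; intro coordinate_measurable) (auto simp: p_def)
    ultimately show "(\<lambda>w. of_bool (\<forall>r\<in>{0..p n k}. w r \<in> U) * (w (p n (Suc k)) - w (p n k)))
        \<in> borel_measurable P"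
      by (rule borel_measurable_times)
  qed
  have "(\<lambda>w. w (exit_time U T w) - w 0) \<in> borel_measurable P"
    by (rule borel_measurable_LIMSEQ_real[OF lim meas])
  then have "(\<lambda>w. (w (exit_time U T w) - w 0) + w 0) \<in> borel_measurable P"
    by (intro borel_measurable_add coordinate_measurable) auto
  then show ?thesis by simp
qed

lemma stopped_measurable:
  assumes U: "open U" and T: "0 < T" and g: "(\<lambda>(s, x). g s x) \<in> borel_measurable borel"
  shows "(\<lambda>w. g (exit_time U T w) (w (exit_time U T w))) \<in> borel_measurable P"
proof -
  have "(\<lambda>w. (exit_time U T w, w (exit_time U T w))) \<in> borel_measurable P"
    using T by (intro borel_measurable_Pair exit_position_measurable U
        borel_measurable_filtration_P[OF exit_time_measurable]) auto
  from measurable_compose[OF this g] show ?thesis by simp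
qed

text \<open>\<open>g\<close> is multiplied by a cutoff that equals 1 on \<open>{b..N}\<close>. There
  the derivatives of the cutoff vanish, so the backward equation of \<open>g\<close> survives as
  \<open>cancel\<close>; and the stopped position lies in the closure of the interval, so
  \<open>g\<close> and the product agree on it.\<close>

lemma expectation_stopped_bounded_interval:
  assumes T: "0 < T" and b: "0 < b" and a: "a \<in> {b<..<N}"
    and gx: "\<And>s x. s \<in> {0..T} \<Longrightarrow> 0 < x \<Longrightarrow> (g s has_real_derivative gx s x) (at x)"
    and gxx: "\<And>s x. s \<in> {0..T} \<Longrightarrow> 0 < x \<Longrightarrow> (gx s has_real_derivative gxx s x) (at x)"
    and gs: "\<And>s x. s \<in> {0..T} \<Longrightarrow> 0 < x \<Longrightarrow>
      ((\<lambda>s. g s x) has_real_derivative - (1 / 2 * gxx s x + (2 * \<nu> + 1) / (2 * x) * gx s x)) (at s)"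
    and cont: "continuous_on ({0..T} \<times> {0<..}) (\<lambda>(s, x). g s x)"
      "continuous_on ({0..T} \<times> {0<..}) (\<lambda>(s, x). gx s x)"
      "continuous_on ({0..T} \<times> {0<..}) (\<lambda>(s, x). gxx s x)"
    and meas: "(\<lambda>(s, x). g s x) \<in> borel_measurable borel"
  shows "expectation (\<lambda>w. g (exit_time {b<..<N} T w) (w (exit_time {b<..<N} T w))) = g 0 a"
proof -
  let ?U = "{b<..<N}"
  have N: "b < N" using a by simp
  obtain \<phi> \<phi>1 \<phi>2 :: "real \<Rightarrow> real" where
    \<phi>: "\<forall>x. (\<phi> has_real_derivative \<phi>1 x) (at x)" "\<forall>x. (\<phi>1 has_real_derivative \<phi>2 x) (at x)"
      "continuous_on UNIV \<phi>2"
    and out: "\<forall>x. x \<le> b / 2 \<or> 2 * N \<le> x \<longrightarrow> \<phi> x = 0 \<and> \<phi>1 x = 0 \<and> \<phi>2 x = 0"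
    and ins: "\<forall>x\<in>{b..N}. \<phi> x = 1 \<and> \<phi>1 x = 0 \<and> \<phi>2 x = 0"
    using cutoff_exists[OF b N] by (elim exE conjE)
  have \<phi>_cont: "continuous_on UNIV \<phi>" "continuous_on UNIV \<phi>1"
    using \<phi>(1,2) by (auto simp: continuous_on_eq_continuous_at intro: DERIV_isCont)
  define h h1 h2 where "h s x = \<phi> x * g s x" and "h1 s x = \<phi>1 x * g s x + \<phi> x * gx s x"
    and "h2 s x = (\<phi>2 x * g s x + \<phi>1 x * gx s x) + (\<phi>1 x * gx s x + \<phi> x * gxx s x)" for s x
  define l where "l s x = 1 / 2 * h2 s x + (2 * \<nu> + 1) / (2 * x) * h1 s x" for s x
  define d where "d s x = \<phi> x * - (1 / 2 * gxx s x + (2 * \<nu> + 1) / (2 * x) * gx s x)" for s x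
  have zero: "h s x = 0" "h1 s x = 0" "h2 s x = 0" "l s x = 0" "d s x = 0"
    if "x \<le> b / 2 \<or> 2 * N \<le> x" for s x
    using out that unfolding h_def h1_def h2_def l_def d_def by auto
  have h1: "(h s has_real_derivative h1 s x) (at x)" if s: "s \<in> {0..T}" for s x
  proof (cases "0 < x")
    case True
    show ?thesis unfolding h_def h1_def
      using DERIV_mult[OF \<phi>(1)[rule_format, of x] gx[OF s True]] by (simp add: algebra_simps)
  next
    case False
    have "((\<lambda>x::real. 0 :: real) has_real_derivative 0) (at x)" by simp
    then have "(h s has_real_derivative 0) (at x)"
      by (rule has_field_derivative_transform_within_open[where S="{..<b/2}"]) (use False b zero in auto)
    then show ?thesis using zero(2)[of x s] False b by simp
  qed
  have h2: "(h1 s has_real_derivative h2 s x) (at x)" if s: "s \<in> {0..T}" for s x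
  proof (cases "0 < x")
    case True
    show ?thesis unfolding h1_def h2_def
      using DERIV_add[OF DERIV_mult[OF \<phi>(2)[rule_format, of x] gx[OF s True]]
          DERIV_mult[OF \<phi>(1)[rule_format, of x] gxx[OF s True]]] by (simp add: algebra_simps)
  next
    case False
    have "((\<lambda>x::real. 0 :: real) has_real_derivative 0) (at x)" by simp
    then have "(h1 s has_real_derivative 0) (at x)"
      by (rule has_field_derivative_transform_within_open[where S="{..<b/2}"]) (use False b zero in auto)
    then show ?thesis using zero(3)[of x s] False b by simp
  qed
  have deriv: "deriv (h s) = h1 s" "deriv (h1 s) = h2 s" if "s \<in> {0..T}" for s
    using h1[OF that] h2[OF that] by (auto intro!: ext DERIV_imp_deriv)
  have gen: "bessel_generator \<nu> (h s) x = l s x" if "s \<in> {0..T}" for s x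
    unfolding bessel_generator_def l_def deriv[OF that] by simp
  have c2: "continuous_on ({0..T} \<times> {0<..}) (\<lambda>z. f (snd z))" if "continuous_on UNIV f" for f :: "real \<Rightarrow> real"
    by (intro continuous_on_compose2[OF that continuous_on_snd] continuous_on_id) auto
  note conts = cont[unfolded case_prod_unfold] c2[OF \<phi>_cont(1)] c2[OF \<phi>_cont(2)] c2[OF \<phi>(3)]
  have ext: "continuous_on ({0..T} \<times> UNIV) (\<lambda>(s, x). F s x)"
    if "continuous_on ({0..T} \<times> {0<..}) (\<lambda>z. F (fst z) (snd z))"
      "\<And>s x. x \<le> b / 2 \<or> 2 * N \<le> x \<Longrightarrow> F s x = 0" for F :: "real \<Rightarrow> real \<Rightarrow> real"
    using that b by (intro continuous_on_extend_zero[where \<beta>="b/2"]) (auto simp: case_prod_unfold)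
  have h_cont: "continuous_on ({0..T} \<times> UNIV) (\<lambda>(s, x). h s x)"
    unfolding h_def by (intro ext continuous_intros conts) (use out in auto)
  have h2_cont: "continuous_on ({0..T} \<times> UNIV) (\<lambda>(s, x). h2 s x)"
    unfolding h2_def by (intro ext continuous_intros conts) (use out in auto)
  have l_cont: "continuous_on ({0..T} \<times> UNIV) (\<lambda>(s, x). l s x)"
    unfolding l_def h2_def h1_def by (intro ext continuous_intros conts) (use out in auto)
  have d_cont: "continuous_on ({0..T} \<times> UNIV) (\<lambda>(s, x). d s x)"
    unfolding d_def by (intro ext continuous_intros conts) (use out in auto)
  have bnd: "\<exists>C. \<forall>s\<in>{0..T}. \<forall>x. \<bar>F s x\<bar> \<le> C"
    if "continuous_on ({0..T} \<times> UNIV) (\<lambda>(s, x). F s x)"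
      "\<And>s x. x \<le> b / 2 \<or> 2 * N \<le> x \<Longrightarrow> F s x = 0" for F :: "real \<Rightarrow> real \<Rightarrow> real"
    by (rule bounded_of_zero_outside[OF that(1), of "b/2" "2 * N"]) (rule that(2))
  obtain C where C: "\<bar>h s x\<bar> \<le> C" "\<bar>d s x\<bar> \<le> C" "\<bar>l s x\<bar> \<le> C" if "s \<in> {0..T}" for s x
  proof -
    obtain C1 where C1: "\<forall>s\<in>{0..T}. \<forall>x. \<bar>h s x\<bar> \<le> C1"
      using bnd[OF h_cont zero(1)] by (rule exE)
    obtain C2 where C2: "\<forall>s\<in>{0..T}. \<forall>x. \<bar>d s x\<bar> \<le> C2"
      using bnd[OF d_cont zero(5)] by (rule exE)
    obtain C3 where C3: "\<forall>s\<in>{0..T}. \<forall>x. \<bar>l s x\<bar> \<le> C3"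
      using bnd[OF l_cont zero(4)] by (rule exE)
    show thesis
    proof (rule that[of "max C1 (max C2 C3)"])
      fix s x assume "s \<in> {0..T}"
      then have "\<bar>h s x\<bar> \<le> C1" "\<bar>d s x\<bar> \<le> C2" "\<bar>l s x\<bar> \<le> C3" using C1 C2 C3 by auto
      then show "\<bar>h s x\<bar> \<le> max C1 (max C2 C3)" "\<bar>d s x\<bar> \<le> max C1 (max C2 C3)"
        "\<bar>l s x\<bar> \<le> max C1 (max C2 C3)" by auto
    qed
  qed
  have test: "test_function (h s)" if s: "s \<in> {0..T}" for s
    unfolding test_function_def deriv[OF s]
  proof (intro conjI allI)
    show "h s differentiable at x" "h1 s differentiable at x" for x
      using h1[OF s] h2[OF s] real_differentiable_def by blast+
    have "continuous_on UNIV (\<lambda>x. (\<lambda>(s, x). h2 s x) (s, x))"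
      using s by (intro continuous_on_compose2[OF h2_cont] continuous_intros) auto
    then show "continuous_on UNIV (h2 s)" by simp
    have sub: "closure {x. h s x \<noteq> 0} \<subseteq> {b/2..2 * N}"
    proof (intro closure_minimal subsetI)
      fix x assume "x \<in> {x. h s x \<noteq> 0}"
      then have "\<not> (x \<le> b / 2 \<or> 2 * N \<le> x)" using zero(1)[of x s] by blast
      then show "x \<in> {b/2..2 * N}" by simp
    qed simp
    then show "compact (closure {x. h s x \<noteq> 0})"
      unfolding compact_eq_bounded_closed by (blast intro: bounded_subset[OF bounded_closed_interval])
    show "closure {x. h s x \<noteq> 0} \<subseteq> {0<..}" using sub b by auto
  qed
  have hs: "((\<lambda>s. h s x) has_real_derivative d s x) (at s)" if s: "s \<in> {0..T}" for s x
  proof (cases "0 < x")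
    case True
    show ?thesis unfolding h_def d_def by (intro DERIV_cmult gs s True)
  next
    case False
    then show ?thesis using zero(1)[of x] zero(5)[of x] b by simp
  qed
  have cancel: "d s x + l s x = 0" if "x \<in> ?U" for s x
    using ins that unfolding d_def l_def h1_def h2_def by simp
  have "expectation (\<lambda>w. h (exit_time ?U T w) (w (exit_time ?U T w))) = h 0 a"
    and hm: "(\<lambda>w. h (exit_time ?U T w) (w (exit_time ?U T w))) \<in> borel_measurable P"
  proof -
    have l_cont': "continuous_on ({0..T} \<times> UNIV) (\<lambda>(s, x). bessel_generator \<nu> (h s) x)"
      by (rule continuous_on_eq[OF l_cont]) (auto simp: gen)
    show "expectation (\<lambda>w. h (exit_time ?U T w) (w (exit_time ?U T w))) = h 0 a"
      "(\<lambda>w. h (exit_time ?U T w) (w (exit_time ?U T w))) \<in> borel_measurable P"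
      by (rule expectation_stopped_test_function[OF _ T test h_cont hs l_cont' C(1,2)];
          simp add: gen C(3) cancel)+
  qed
  moreover have "h 0 a = g 0 a" using ins a by (simp add: h_def)
  moreover have "expectation (\<lambda>w. h (exit_time ?U T w) (w (exit_time ?U T w)))
      = expectation (\<lambda>w. g (exit_time ?U T w) (w (exit_time ?U T w)))"
  proof (intro integral_cong_AE hm stopped_measurable T meas)
    have "AE w in P. w \<in> space P" by (rule AE_space)
    with start show "AE w in P. h (exit_time ?U T w) (w (exit_time ?U T w))
        = g (exit_time ?U T w) (w (exit_time ?U T w))"
    proof eventually_elim
      case (elim w)
      have "w (exit_time ?U T w) \<in> closure ?U"
        using elim a by (intro exit_position_in_closure path_continuous T) auto
      then have "w (exit_time ?U T w) \<in> {b..N}" using N by simp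
      then show ?case using ins by (simp add: h_def)
    qed
  qed simp
  ultimately show ?thesis by simp
qed

end

section \<open>Stopping at the lower level only\<close>

lemma exit_time_eq_horizon:
  assumes "\<And>s. s \<in> {0..T} \<Longrightarrow> w s \<in> U"
  shows "exit_time U T w = T"
proof -
  have "insert T {s \<in> {0..T}. w s \<notin> U} = {T}" using assms by auto
  then show ?thesis unfolding exit_time_def by (metis cInf_singleton)
qed

lemma exit_position_half_line:
  assumes w: "continuous_on {0..T} w" and T: "0 < T" and "b < w 0" and ex: "\<not> (\<forall>r\<in>{0..T}. b < w r)"
  shows "w (exit_time {b<..} T w) = b"
proof -
  let ?\<sigma> = "exit_time {b<..} T w"
  have "w ?\<sigma> \<in> closure {b<..}" using assms by (intro exit_position_in_closure) auto
  then have "b \<le> w ?\<sigma>" by simp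
  moreover have "w ?\<sigma> \<notin> {b<..}"
  proof (cases "?\<sigma> < T")
    case True
    then show ?thesis using T by (intro at_exit_time[OF w]) auto
  next
    \<comment> \<open>The path reaches the level exactly at the horizon: before \<open>T\<close> it
      is above \<open>b\<close>, so the only time with \<open>w r \<le> b\<close> is
      \<open>T\<close> itself.\<close>
    case False
    then have \<sigma>: "?\<sigma> = T" using exit_time_bounds(2)[of T "{b<..}" w] T by simp
    obtain r where r: "r \<in> {0..T}" "w r \<le> b" using ex by force
    then have "\<not> r < ?\<sigma>" using before_exit_time[of r "{b<..}" T w] T by auto
    then have "r = T" using r \<sigma> by simp
    then show ?thesis using r \<sigma> by simp
  qed
  ultimately show ?thesis by simp
qed

context bessel begin

text \<open>The upper end of the interval tends to infinity. A path is bounded on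
  \<open>{0..T}\<close>, so its exit times from \<open>U n\<close> eventually equal the one from the
  half-line; the bound on \<open>g\<close> for \<open>x \<ge> b\<close> gives dominated
  convergence.\<close>

lemma expectation_stopped_half_line:
  assumes T: "0 < T" and b: "0 < b" and a: "b < a"
    and gx: "\<And>s x. s \<in> {0..T} \<Longrightarrow> 0 < x \<Longrightarrow> (g s has_real_derivative gx s x) (at x)"
    and gxx: "\<And>s x. s \<in> {0..T} \<Longrightarrow> 0 < x \<Longrightarrow> (gx s has_real_derivative gxx s x) (at x)"
    and gs: "\<And>s x. s \<in> {0..T} \<Longrightarrow> 0 < x \<Longrightarrow>
      ((\<lambda>s. g s x) has_real_derivative - (1 / 2 * gxx s x + (2 * \<nu> + 1) / (2 * x) * gx s x)) (at s)"
    and cont: "continuous_on ({0..T} \<times> {0<..}) (\<lambda>(s, x). g s x)"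
      "continuous_on ({0..T} \<times> {0<..}) (\<lambda>(s, x). gx s x)"
      "continuous_on ({0..T} \<times> {0<..}) (\<lambda>(s, x). gxx s x)"
    and meas: "(\<lambda>(s, x). g s x) \<in> borel_measurable borel"
    and bound: "\<And>s x. s \<in> {0..T} \<Longrightarrow> b \<le> x \<Longrightarrow> \<bar>g s x\<bar> \<le> C"
  shows "expectation (\<lambda>w. if \<forall>r\<in>{0..T}. b < w r then g T (w T) else g (exit_time {b<..} T w) b) = g 0 a"
    and "integrable P (\<lambda>w. if \<forall>r\<in>{0..T}. b < w r then g T (w T) else g (exit_time {b<..} T w) b)"
proof -
  define Z where "Z U w = g (exit_time U T w) (w (exit_time U T w))" for U w
  \<comment> \<open>The summand \<open>a + 1\<close> puts the starting point inside every
    \<open>U n\<close>, also for \<open>n = 0\<close>.\<close>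
  define U where "U n = {b<..<a + 1 + real n}" for n :: nat
  let ?Y = "\<lambda>w. if \<forall>r\<in>{0..T}. b < w r then g T (w T) else g (exit_time {b<..} T w) b"
  have Zm: "Z V \<in> borel_measurable P" if "open V" for V
    unfolding Z_def by (rule stopped_measurable[OF that T meas])
  have Yeq: "Z {b<..} w = ?Y w" if "w \<in> space P" "w 0 = a" for w
  proof (cases "\<forall>r\<in>{0..T}. b < w r")
    case True
    then show ?thesis using exit_time_eq_horizon[of T w "{b<..}"] by (simp add: Z_def)
  next
    case False
    then show ?thesis
      using exit_position_half_line[of T w b] path_continuous[of w 0 T] that a T by (auto simp: Z_def)
  qed
  have stay: "{w \<in> space P. \<forall>r\<in>{0..T}. b < w r} \<in> sets P"
    using sets_filtration_P[OF stays_open_measurable[of 0 T T "{b<..}"]] by simp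
  have Ym: "?Y \<in> borel_measurable P"
  proof (rule measurable_If)
    have "(\<lambda>w. (T, w T)) \<in> borel_measurable P"
      using T by (intro borel_measurable_Pair borel_measurable_const coordinate_measurable) auto
    from measurable_compose[OF this meas] show "(\<lambda>w. g T (w T)) \<in> borel_measurable P" by simp
    have "(\<lambda>w. (exit_time {b<..} T w, b)) \<in> borel_measurable P"
      using T by (intro borel_measurable_Pair borel_measurable_const
          borel_measurable_filtration_P[OF exit_time_measurable]) auto
    from measurable_compose[OF this meas] show "(\<lambda>w. g (exit_time {b<..} T w) b) \<in> borel_measurable P" by simp
  qed (rule stay)
  have a_U: "a \<in> U n" for n using a by (simp add: U_def)
  have Z_bound: "\<bar>Z (U n) w\<bar> \<le> C" if "w \<in> space P" "w 0 = a" for n w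
  proof -
    have "w (exit_time (U n) T w) \<in> closure (U n)"
      using that a_U by (intro exit_position_in_closure path_continuous T) auto
    then have "b \<le> w (exit_time (U n) T w)" using a by (simp add: U_def)
    then show ?thesis unfolding Z_def using exit_time_bounds[of T "U n" w] T by (intro bound) auto
  qed
  have Z_lim: "(\<lambda>n. Z (U n) w) \<longlonglongrightarrow> Z {b<..} w" if w: "w \<in> space P" for w
  proof (rule tendsto_eventually)
    have "compact (w ` {0..T})" using path_continuous w by (intro compact_continuous_image) auto
    then obtain M where M: "\<forall>y\<in>w ` {0..T}. norm y \<le> M" using compact_imp_bounded bounded_iff by blast
    have "eventually (\<lambda>n. real n > M) sequentially"
      using filterlim_real_sequentially unfolding filterlim_at_top_dense by blast
    then show "eventually (\<lambda>n. Z (U n) w = Z {b<..} w) sequentially"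
    proof eventually_elim
      case (elim n)
      have "w s \<in> U n \<longleftrightarrow> w s \<in> {b<..}" if "s \<in> {0..T}" for s
      proof -
        have "w s \<le> M" using M that by force
        then show ?thesis using elim a b unfolding U_def by auto
      qed
      then have "{s \<in> {0..T}. w s \<notin> U n} = {s \<in> {0..T}. w s \<notin> {b<..}}" by blast
      then show ?case unfolding Z_def exit_time_def by simp
    qed
  qed
  have "(\<lambda>n. expectation (Z (U n))) \<longlonglongrightarrow> expectation (Z {b<..})"
  proof (intro integral_dominated_convergence[where w="\<lambda>_. C"] Zm)
    have "AE w in P. w \<in> space P" by (rule AE_space)
    with start show "AE w in P. norm (Z (U n) w) \<le> C" for n
      by eventually_elim (use Z_bound in auto)
  qed (use Z_lim in \<open>auto simp: U_def\<close>)
  moreover have "expectation (Z (U n)) = g 0 a" for n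
    unfolding Z_def U_def
    by (rule expectation_stopped_bounded_interval[OF T b _ gx gxx gs cont meas]) (use a in auto)
  ultimately have "expectation (Z {b<..}) = g 0 a" by (simp add: LIMSEQ_const_iff)
  also have "expectation (Z {b<..}) = expectation ?Y"
  proof (intro integral_cong_AE Zm Ym)
    have "AE w in P. w \<in> space P" by (rule AE_space)
    with start show "AE w in P. Z {b<..} w = ?Y w" by eventually_elim (rule Yeq)
  qed simp
  finally show "expectation ?Y = g 0 a" .
  show "integrable P ?Y"
  proof (rule integrable_const_bound[OF _ Ym])
    have "AE w in P. w \<in> space P" by (rule AE_space)
    with start show "AE w in P. norm (?Y w) \<le> C"
    proof eventually_elim
      case (elim w)
      have "exit_time {b<..} T w \<in> {0..T}" using exit_time_bounds[of T "{b<..}" w] T by auto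
      then show ?case using T bound[of T "w T"] bound[of "exit_time {b<..} T w" b]
        by (auto simp: less_imp_le)
    qed
  qed
qed

end

subsection \<open>The heat kernel and its tail\<close>

text \<open>Up to a constant, the fundamental solution at the origin: \<open>\<partial>\<^sub>r heat = L heat\<close> for the
  generator \<open>L\<close> of index \<open>\<nu>\<close>.\<close>

definition heat :: "real \<Rightarrow> real \<Rightarrow> real \<Rightarrow> real" where
  "heat \<nu> r x = r powr (- \<nu> - 1) * exp (- (x\<^sup>2 / (2 * r)))"

text \<open>The function \<open>u\<close> of the overview; at \<open>t = 0\<close> it is, up to a
  constant, the Green function with pole at the origin. Values in \<open>ennreal\<close> let Tonelli
  apply without integrability conditions.\<close>

definition heat_tail :: "real \<Rightarrow> real \<Rightarrow> real \<Rightarrow> ennreal" where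
  "heat_tail \<nu> t x = (\<integral>\<^sup>+ r. ennreal (heat \<nu> r x) * indicator {t<..} r \<partial>lborel)"

lemma heat_nonneg: "0 \<le> heat \<nu> r x"
  by (simp add: heat_def)

lemma heat_measurable [measurable]:
  "(\<lambda>(r, x). heat \<nu> r x) \<in> borel_measurable (borel \<Otimes>\<^sub>M borel)"
  unfolding heat_def by measurable

lemma heat_tail_antimono: "s \<le> t \<Longrightarrow> heat_tail \<nu> t x \<le> heat_tail \<nu> s x"
  unfolding heat_tail_def by (intro nn_integral_mono) (auto simp: indicator_def)

lemma heat_tail_atLeast:
  "heat_tail \<nu> t x = (\<integral>\<^sup>+ r. ennreal (heat \<nu> r x) * indicator {t..} r \<partial>lborel)"
  unfolding heat_tail_def
proof (rule nn_integral_cong_AE)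
  have "AE r in lborel. r \<noteq> t" by (rule AE_lborel_singleton)
  then show "AE r in lborel. ennreal (heat \<nu> r x) * indicator {t<..} r = ennreal (heat \<nu> r x) * indicator {t..} r"
    by eventually_elim (auto simp: indicator_def)
qed

lemma nn_integral_powr_tail:
  assumes "0 < p" "0 < (t::real)"
  shows "(\<integral>\<^sup>+ r. ennreal (r powr (- p - 1)) * indicator {t..} r \<partial>lborel) = ennreal (t powr (- p) / p)"
proof -
  have "(\<integral>\<^sup>+ r. ennreal (r powr (- p - 1)) * indicator {t..} r \<partial>lborel)
      = ennreal (0 - (- (t powr (- p) / p)))"
  proof (rule nn_integral_FTC_atLeast)
    fix r assume "t \<le> r"
    then have "0 < r" using assms by simp
    then show "((\<lambda>r. - (r powr (- p) / p)) has_real_derivative r powr (- p - 1)) (at r)"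
      using assms by (auto intro!: derivative_eq_intros)
  next
    have "((\<lambda>r::real. r powr (- p)) \<longlongrightarrow> 0) at_top"
      using assms by (intro tendsto_neg_powr filterlim_ident) auto
    then have "((\<lambda>r::real. - (r powr (- p) / p)) \<longlongrightarrow> - (0 / p)) at_top"
      by (intro tendsto_intros) (use assms in auto)
    then show "((\<lambda>r::real. - (r powr (- p) / p)) \<longlongrightarrow> 0) at_top" by simp
  qed (auto simp: assms)
  then show ?thesis by simp
qed

lemma heat_tail_le:
  assumes "0 < \<nu>" "0 < t" shows "heat_tail \<nu> t x \<le> ennreal (t powr (- \<nu>) / \<nu>)"
proof -
  have "heat_tail \<nu> t x \<le> (\<integral>\<^sup>+ r. ennreal (r powr (- \<nu> - 1)) * indicator {t..} r \<partial>lborel)"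
    unfolding heat_tail_atLeast
  proof (rule nn_integral_mono)
    fix r :: real
    have "heat \<nu> r x \<le> r powr (- \<nu> - 1)" if "t \<le> r"
      unfolding heat_def using that assms by (intro mult_right_le_one_le) auto
    then show "ennreal (heat \<nu> r x) * indicator {t..} r \<le> ennreal (r powr (- \<nu> - 1)) * indicator {t..} r"
      by (auto simp: indicator_def intro: ennreal_leI)
  qed
  then show ?thesis using nn_integral_powr_tail[OF assms] by simp
qed

text \<open>From \<open>1 - y \<le> exp (- y)\<close> with \<open>y = x\<^sup>2 / (2 * r)\<close>,
  integrated over \<open>r\<close>. The error stands on the right because subtraction in
  \<open>ennreal\<close> truncates.\<close>

lemma heat_tail_ge:
  assumes "0 < \<nu>" "0 < t"
  shows "ennreal (t powr (- \<nu>) / \<nu>) \<le> heat_tail \<nu> t x + ennreal (x\<^sup>2 / (2 * (\<nu> + 1)) * t powr (- \<nu> - 1))"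
proof -
  have "ennreal (t powr (- \<nu>) / \<nu>) = (\<integral>\<^sup>+ r. ennreal (r powr (- \<nu> - 1)) * indicator {t..} r \<partial>lborel)"
    using nn_integral_powr_tail[OF assms] by simp
  also have "\<dots> \<le> (\<integral>\<^sup>+ r. ennreal (heat \<nu> r x) * indicator {t..} r
      + ennreal (x\<^sup>2 / 2) * (ennreal (r powr (- (\<nu> + 1) - 1)) * indicator {t..} r) \<partial>lborel)"
  proof (rule nn_integral_mono)
    fix r :: real
    have "r powr (- \<nu> - 1) \<le> heat \<nu> r x + x\<^sup>2 / 2 * r powr (- (\<nu> + 1) - 1)" if "t \<le> r"
    proof -
      have r: "0 < r" using that assms by simp
      have "1 - x\<^sup>2 / (2 * r) \<le> exp (- (x\<^sup>2 / (2 * r)))" using exp_ge_add_one_self[of "- (x\<^sup>2 / (2 * r))"] by simp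
      then have "r powr (- \<nu> - 1) * (1 - x\<^sup>2 / (2 * r)) \<le> heat \<nu> r x"
        unfolding heat_def by (intro mult_left_mono) auto
      moreover have "r powr (- (\<nu> + 1) - 1) = r powr (- \<nu> - 1) / r"
        using r powr_diff[of r "- \<nu> - 1" 1] by (simp add: algebra_simps)
      ultimately show ?thesis by (simp add: algebra_simps)
    qed
    then show "ennreal (r powr (- \<nu> - 1)) * indicator {t..} r \<le> ennreal (heat \<nu> r x) * indicator {t..} r
      + ennreal (x\<^sup>2 / 2) * (ennreal (r powr (- (\<nu> + 1) - 1)) * indicator {t..} r)"
      by (auto simp: indicator_def heat_nonneg ennreal_mult[symmetric] ennreal_plus[symmetric]
          intro!: ennreal_leI simp del: ennreal_plus)
  qed
  also have "\<dots> = heat_tail \<nu> t x + ennreal (x\<^sup>2 / 2) * ennreal (t powr (- (\<nu> + 1)) / (\<nu> + 1))"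
    unfolding heat_tail_atLeast
    by (subst nn_integral_add, simp, simp, subst nn_integral_cmult, simp,
        subst nn_integral_powr_tail) (use assms in simp_all)
  also have "ennreal (x\<^sup>2 / 2) * ennreal (t powr (- (\<nu> + 1)) / (\<nu> + 1))
      = ennreal (x\<^sup>2 / (2 * (\<nu> + 1)) * t powr (- \<nu> - 1))"
  proof -
    have "- (\<nu> + 1) = - \<nu> - 1" by simp
    then show ?thesis using assms by (simp only: ennreal_mult[symmetric]) (simp add: ennreal_mult[symmetric] field_simps)
  qed
  finally show ?thesis .
qed

text \<open>The substitution \<open>v = x\<^sup>2 / (2 * r)\<close> maps the positive half-line onto
  itself and turns the integral into Euler's integral for the Gamma function.\<close>

lemma heat_tail_zero:
  assumes \<nu>: "0 < \<nu>" and x: "0 < x"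
  shows "heat_tail \<nu> 0 x = ennreal (2 powr \<nu> * Gamma \<nu> * x powr (- 2 * \<nu>))"
proof -
  define f where "f v = v powr (\<nu> - 1) / exp v" for v :: real
  define \<gamma> where "\<gamma> r = x\<^sup>2 / (2 * r)" for r :: real
  define \<gamma>' where "\<gamma>' r = - (x\<^sup>2 / (2 * r\<^sup>2))" for r :: real
  have "(f has_integral Gamma \<nu>) {0..}" unfolding f_def by (rule Gamma_integral_real[OF \<nu>])
  then have f: "(f has_integral Gamma \<nu>) {0<..}"
    by (rule has_integral_spike_set_eq[THEN iffD1, rotated 2]) (auto intro: negligible_subset[of "{0}"])
  have f_abs: "f absolutely_integrable_on {0<..}"
    using f by (intro nonnegative_absolutely_integrable_1) (auto simp: f_def has_integral_integrable)
  have img: "\<gamma> ` {0<..} = {0<..}"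
  proof
    show "{0<..} \<subseteq> \<gamma> ` {0<..}"
    proof
      fix v :: real assume "v \<in> {0<..}"
      then have "v = \<gamma> (x\<^sup>2 / (2 * v))" "x\<^sup>2 / (2 * v) \<in> {0<..}" using x by (auto simp: \<gamma>_def)
      then show "v \<in> \<gamma> ` {0<..}" by blast
    qed
  qed (use x in \<open>auto simp: \<gamma>_def\<close>)
  have "(\<lambda>r. \<bar>\<gamma>' r\<bar> * f (\<gamma> r)) absolutely_integrable_on {0<..} \<and>
      integral {0<..} (\<lambda>r. \<bar>\<gamma>' r\<bar> * f (\<gamma> r)) = Gamma \<nu>"
  proof (rule has_absolute_integral_change_of_variables_1'[of "{0<..}" \<gamma> \<gamma>' f "Gamma \<nu>", THEN iffD2])
    show "inj_on \<gamma> {0<..}" using x by (auto simp: inj_on_def \<gamma>_def)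
    show "(\<gamma> has_field_derivative \<gamma>' r) (at r within {0<..})" if "r \<in> {0<..}" for r
      unfolding \<gamma>_def \<gamma>'_def using that by (auto intro!: derivative_eq_intros simp: power2_eq_square)
    show "f absolutely_integrable_on \<gamma> ` {0<..} \<and> integral (\<gamma> ` {0<..}) f = Gamma \<nu>"
      unfolding img using f f_abs integral_unique by blast
  qed auto
  then have "((\<lambda>r. \<bar>\<gamma>' r\<bar> * f (\<gamma> r)) has_integral Gamma \<nu>) {0<..}"
    using set_lebesgue_integral_eq_integral(1) by (auto simp: has_integral_integrable_integral)
  then have "((\<lambda>r. (x\<^sup>2 / 2) powr \<nu> * heat \<nu> r x) has_integral Gamma \<nu>) {0<..}"
  proof (rule has_integral_eq[rotated])
    fix r :: real assume "r \<in> {0<..}"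
    then have r: "0 < r" by simp
    have "\<bar>\<gamma>' r\<bar> * f (\<gamma> r) = (x\<^sup>2 / 2 / r\<^sup>2) * ((x\<^sup>2 / 2) / r) powr (\<nu> - 1) * exp (- (x\<^sup>2 / (2 * r)))"
      by (simp add: \<gamma>'_def f_def \<gamma>_def exp_minus field_simps)
    also have "((x\<^sup>2 / 2) / r) powr (\<nu> - 1) = (x\<^sup>2 / 2) powr (\<nu> - 1) * r powr (1 - \<nu>)"
      using powr_divide[of "x\<^sup>2 / 2" r "\<nu> - 1"] powr_minus[of r "\<nu> - 1"] r
      by (simp only: minus_diff_eq divide_inverse)
    also have "(x\<^sup>2 / 2) powr (\<nu> - 1) = (x\<^sup>2 / 2) powr \<nu> / (x\<^sup>2 / 2)"
      using x by (simp add: powr_diff)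
    also have "r powr (1 - \<nu>) = r powr (- \<nu> - 1) * r\<^sup>2"
      using r powr_add[of r "- \<nu> - 1" 2] by (simp add: powr_numeral)
    finally show "\<bar>\<gamma>' r\<bar> * f (\<gamma> r) = (x\<^sup>2 / 2) powr \<nu> * heat \<nu> r x"
      using r x by (simp add: heat_def field_simps)
  qed
  then have "(\<integral>\<^sup>+ r. ennreal ((x\<^sup>2 / 2) powr \<nu> * heat \<nu> r x) * indicator {0<..} r \<partial>lborel) = ennreal (Gamma \<nu>)"
    by (intro nn_integral_has_integral_lebesgue') (auto simp: heat_nonneg)
  also have "(\<integral>\<^sup>+ r. ennreal ((x\<^sup>2 / 2) powr \<nu> * heat \<nu> r x) * indicator {0<..} r \<partial>lborel)
      = ennreal ((x\<^sup>2 / 2) powr \<nu>) * heat_tail \<nu> 0 x"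
    unfolding heat_tail_def
    by (subst nn_integral_cmult[symmetric]) (auto simp: ennreal_mult heat_nonneg ac_simps intro!: nn_integral_cong)
  finally have *: "ennreal ((x\<^sup>2 / 2) powr \<nu>) * heat_tail \<nu> 0 x = ennreal (Gamma \<nu>)" .
  \<comment> \<open>Multiplying by this explicit reciprocal takes the place of a division in
    \<open>ennreal\<close>.\<close>
  have k: "2 powr \<nu> * x powr (- 2 * \<nu>) * (x\<^sup>2 / 2) powr \<nu> = 1"
  proof -
    have "(x\<^sup>2) powr \<nu> = x powr (2 * \<nu>)" using x by (simp add: powr_powr[symmetric] powr_numeral)
    then show ?thesis using x by (simp add: powr_divide powr_minus)
  qed
  have "heat_tail \<nu> 0 x = ennreal (2 powr \<nu> * x powr (- 2 * \<nu>) * (x\<^sup>2 / 2) powr \<nu>) * heat_tail \<nu> 0 x"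
    unfolding k by simp
  also have "\<dots> = ennreal (2 powr \<nu> * x powr (- 2 * \<nu>)) * (ennreal ((x\<^sup>2 / 2) powr \<nu>) * heat_tail \<nu> 0 x)"
    by (simp add: ennreal_mult mult.assoc)
  also have "\<dots> = ennreal (2 powr \<nu> * x powr (- 2 * \<nu>)) * ennreal (Gamma \<nu>)" unfolding * ..
  also have "\<dots> = ennreal (2 powr \<nu> * Gamma \<nu> * x powr (- 2 * \<nu>))"
    using \<nu> by (simp add: ennreal_mult[symmetric] Gamma_real_pos less_imp_le ac_simps)
  finally show ?thesis .
qed

lemma has_real_derivative_heat_space:
  assumes "0 < r"
  shows "(heat \<nu> r has_real_derivative - (x / r) * heat \<nu> r x) (at x)"
    "((\<lambda>x. - (x / r) * heat \<nu> r x) has_real_derivative (x\<^sup>2 / r\<^sup>2 - 1 / r) * heat \<nu> r x) (at x)"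
proof -
  have *: "(heat \<nu> r has_real_derivative - (x / r) * heat \<nu> r x) (at x)" for x
    unfolding heat_def using assms by (auto intro!: derivative_eq_intros)
  show "(heat \<nu> r has_real_derivative - (x / r) * heat \<nu> r x) (at x)" by (rule *)
  show "((\<lambda>x. - (x / r) * heat \<nu> r x) has_real_derivative (x\<^sup>2 / r\<^sup>2 - 1 / r) * heat \<nu> r x) (at x)"
  proof -
    have "((\<lambda>x. - (x / r)) has_real_derivative - (1 / r)) (at x)"
      using assms by (auto intro!: derivative_eq_intros)
    from DERIV_mult[OF this *] show ?thesis
      by (rule DERIV_cong) (simp add: algebra_simps power2_eq_square)
  qed
qed

lemma has_real_derivative_heat_time:
  assumes "0 < r"
  shows "((\<lambda>r. heat \<nu> r x) has_real_derivative (x\<^sup>2 / (2 * r\<^sup>2) - (\<nu> + 1) / r) * heat \<nu> r x) (at r)"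
proof -
  have 1: "((\<lambda>r. r powr (- \<nu> - 1)) has_real_derivative (- \<nu> - 1) * r powr (- \<nu> - 1) / r) (at r)"
    using has_real_derivative_powr[OF assms, of "- \<nu> - 1"] powr_diff[of r "- \<nu> - 1" 1] assms by simp
  have 2: "((\<lambda>r. exp (- (x\<^sup>2 / (2 * r)))) has_real_derivative exp (- (x\<^sup>2 / (2 * r))) * (x\<^sup>2 / (2 * r\<^sup>2))) (at r)"
    using assms by (auto intro!: derivative_eq_intros simp: power2_eq_square)
  show ?thesis
    unfolding heat_def using DERIV_mult[OF 1 2] assms by (simp add: field_simps)
qed

lemma heat_le: "0 < r \<Longrightarrow> heat \<nu> r x \<le> r powr (- \<nu> - 1)"
  unfolding heat_def by (intro mult_right_le_one_le) auto

section \<open>Optional stopping for the heat kernel and for the scale function\<close>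

context bessel begin

definition stays :: "real \<Rightarrow> real \<Rightarrow> (real \<Rightarrow> real) \<Rightarrow> bool" where
  "stays b T w \<longleftrightarrow> (\<forall>r\<in>{0..T}. b < w r)"

lemma stays_sets: "0 \<le> T \<Longrightarrow> {w \<in> space P. stays b T w} \<in> sets P"
  unfolding stays_def using sets_filtration_P[OF stays_open_measurable[of 0 T T "{b<..}"]] by simp

text \<open>Since \<open>heat\<close> solves the forward equation in \<open>r\<close>, reversing the
  clock by \<open>r = S - s\<close> gives a solution of the backward equation. With
  \<open>T < S\<close> the remaining time is at least \<open>S - T\<close>, which keeps away from
  the singularity at \<open>r = 0\<close> and gives the bound.\<close>

lemma expectation_heat:
  assumes T: "0 < T" and b: "0 < b" and a: "b < a" and S: "T < S"
  shows "expectation (\<lambda>w. if stays b T w then heat \<nu> (S - T) (w T) else heat \<nu> (S - exit_time {b<..} T w) b)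
      = heat \<nu> S a" (is ?A)
    and "integrable P (\<lambda>w. if stays b T w then heat \<nu> (S - T) (w T) else heat \<nu> (S - exit_time {b<..} T w) b)"
      (is ?B)
proof -
  let ?g = "\<lambda>s. heat \<nu> (S - s)"
  let ?gx = "\<lambda>s x. - (x / (S - s)) * heat \<nu> (S - s) x"
  let ?gxx = "\<lambda>s x. (x\<^sup>2 / (S - s)\<^sup>2 - 1 / (S - s)) * heat \<nu> (S - s) x"
  have pos: "0 < S - s" if "s \<in> {0..T}" for s using that S by auto
  have gs: "((\<lambda>s. ?g s x) has_real_derivative - (1 / 2 * ?gxx s x + (2 * \<nu> + 1) / (2 * x) * ?gx s x)) (at s)"
    if "s \<in> {0..T}" "0 < x" for s x
  proof -
    have "((\<lambda>s. ?g s x) has_real_derivative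
        ((x\<^sup>2 / (2 * (S - s)\<^sup>2) - (\<nu> + 1) / (S - s)) * heat \<nu> (S - s) x) * (0 - 1)) (at s)"
      by (rule DERIV_chain2[where f = "\<lambda>r. heat \<nu> r x" and g = "\<lambda>s. S - s",
            OF has_real_derivative_heat_time[OF pos[OF that(1)]]])
        (auto intro!: derivative_eq_intros)
    \<comment> \<open>The drift contributes \<open>- (2 * \<nu> + 1) / (2 * r)\<close> and the
      second derivative \<open>- 1 / (2 * r)\<close>; their sum \<open>- (\<nu> + 1) / r\<close> is
      the origin of the power in \<open>heat\<close>. With the kernel abstracted to \<open>h\<close>
      this is a rational identity.\<close>
    moreover have "(x\<^sup>2 / (2 * r\<^sup>2) - (\<nu> + 1) / r) * h * (0 - 1)
        = - (1 / 2 * ((x\<^sup>2 / r\<^sup>2 - 1 / r) * h) + (2 * \<nu> + 1) / (2 * x) * (- (x / r) * h))"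
      if "0 < r" for r h :: real
      using that \<open>0 < x\<close> by (simp add: field_simps power2_eq_square)
    ultimately show ?thesis using pos[OF that(1)] by metis
  qed
  have c: "continuous_on ({0..T} \<times> {0<..}) (\<lambda>z. heat \<nu> (S - fst z) (snd z))"
    unfolding heat_def using S by (intro continuous_intros) auto
  have cont: "continuous_on ({0..T} \<times> {0<..}) (\<lambda>(s, x). ?g s x)"
    "continuous_on ({0..T} \<times> {0<..}) (\<lambda>(s, x). ?gx s x)"
    "continuous_on ({0..T} \<times> {0<..}) (\<lambda>(s, x). ?gxx s x)"
    unfolding case_prod_unfold using S by (intro continuous_intros c; force)+
  have meas: "(\<lambda>(s, x). ?g s x) \<in> borel_measurable borel"
    unfolding heat_def borel_prod[symmetric] by measurable
  have bound: "\<bar>?g s x\<bar> \<le> (S - T) powr (- \<nu> - 1)" if "s \<in> {0..T}" "b \<le> x" for s x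
  proof -
    have "heat \<nu> (S - s) x \<le> (S - s) powr (- \<nu> - 1)" using pos that by (intro heat_le) auto
    also have "\<dots> \<le> (S - T) powr (- \<nu> - 1)"
      using that S index_pos by (intro powr_mono2') auto
    finally show ?thesis by (simp add: heat_nonneg)
  qed
  note * = expectation_stopped_half_line[OF T b a _ _ gs cont meas bound]
  have d: "(?g s has_real_derivative ?gx s x) (at x)" "(?gx s has_real_derivative ?gxx s x) (at x)"
    if "s \<in> {0..T}" for s x
    using has_real_derivative_heat_space[OF pos[OF that]] by auto
  have "expectation (\<lambda>w. if stays b T w then ?g T (w T) else ?g (exit_time {b<..} T w) b) = ?g 0 a"
    unfolding stays_def by (rule *(1)[OF d(1) d(2)])
  then show ?A by simp
  show ?B unfolding stays_def by (rule *(2)[OF d(1) d(2)])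
qed

text \<open>\<open>x powr (- 2 * \<nu>)\<close> is the decreasing scale function: the generator
  annihilates it, and it is bounded on \<open>x \<ge> b\<close>.\<close>

lemma expectation_scale:
  assumes T: "0 < T" and b: "0 < b" and a: "b < a"
  shows "expectation (\<lambda>w. if stays b T w then w T powr (- 2 * \<nu>) else b powr (- 2 * \<nu>))
      = a powr (- 2 * \<nu>)" (is ?A)
    and "integrable P (\<lambda>w. if stays b T w then w T powr (- 2 * \<nu>) else b powr (- 2 * \<nu>))" (is ?B)
proof -
  let ?g = "\<lambda>(s::real) x::real. x powr (- 2 * \<nu>)"
  let ?gx = "\<lambda>(s::real) x::real. - 2 * \<nu> * x powr (- 2 * \<nu> - 1)"
  let ?gxx = "\<lambda>(s::real) x::real. - 2 * \<nu> * ((- 2 * \<nu> - 1) * x powr (- 2 * \<nu> - 1 - 1))"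
  have gx: "(?g s has_real_derivative ?gx s x) (at x)" if "0 < x" for s x
    using has_real_derivative_powr[OF that, of "- 2 * \<nu>"] by simp
  have gxx: "(?gx s has_real_derivative ?gxx s x) (at x)" if "0 < x" for s x
    by (intro DERIV_cmult has_real_derivative_powr that)
  have gs: "((\<lambda>s. ?g s x) has_real_derivative - (1 / 2 * ?gxx s x + (2 * \<nu> + 1) / (2 * x) * ?gx s x)) (at s)"
    if "0 < x" for s x
  proof -
    have eq: "x powr (- 2 * \<nu> - 1 - 1) = x powr (- 2 * \<nu> - 1) / x"
      using powr_diff[of x "- 2 * \<nu> - 1" 1] that by simp
    have "- (1 / 2 * ?gxx s x + (2 * \<nu> + 1) / (2 * x) * ?gx s x) = 0"
      unfolding eq using that by (simp add: field_simps)
    then show ?thesis by simp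
  qed
  have cont: "continuous_on ({0..T} \<times> {0<..}) (\<lambda>(s, x). ?g s x)"
    "continuous_on ({0..T} \<times> {0<..}) (\<lambda>(s, x). ?gx s x)"
    "continuous_on ({0..T} \<times> {0<..}) (\<lambda>(s, x). ?gxx s x)"
    unfolding case_prod_unfold by (intro continuous_intros; force)+
  have meas: "(\<lambda>(s, x). ?g s x) \<in> borel_measurable borel"
    unfolding borel_prod[symmetric] by measurable
  have bound: "\<bar>?g s x\<bar> \<le> b powr (- 2 * \<nu>)" if "b \<le> x" for s x
    using that b index_pos by (auto intro!: powr_mono2')
  note * = expectation_stopped_half_line[OF T b a gx gxx gs cont meas bound]
  show ?A ?B unfolding stays_def by (rule *; assumption)+
qed

end

subsection \<open>The distribution of the hitting time\<close>

lemma heat_tail_shift: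
  "(\<integral>\<^sup>+ S. ennreal (heat \<nu> (S - c) x) * indicator {T<..} S \<partial>lborel) = heat_tail \<nu> (T - c) x"
proof -
  have [measurable]: "(\<lambda>S. heat \<nu> (S - c) x) \<in> borel_measurable borel" unfolding heat_def by measurable
  have "(\<integral>\<^sup>+ S. ennreal (heat \<nu> (S - c) x) * indicator {T<..} S \<partial>lborel)
      = (\<integral>\<^sup>+ S. ennreal (heat \<nu> (c + 1 * S - c) x) * indicator {T<..} (c + 1 * S) \<partial>lborel)"
    by (subst nn_integral_real_affine[where c=1 and t=c]) simp_all
  also have "\<dots> = heat_tail \<nu> (T - c) x"
    unfolding heat_tail_def by (intro nn_integral_cong) (auto simp: indicator_def)
  finally show ?thesis .
qed

text \<open>\<open>enn2real\<close> sends infinity to 0; \<open>ennreal_tail\<close> shows that no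
  value is lost for positive \<open>\<nu>\<close> and \<open>x\<close> and
  \<open>0 \<le> t\<close>.\<close>

definition tail :: "real \<Rightarrow> real \<Rightarrow> real \<Rightarrow> real" where
  "tail \<nu> t x = enn2real (heat_tail \<nu> t x)"

lemma tail_nonneg: "0 \<le> tail \<nu> t x"
  by (simp add: tail_def)

lemma ennreal_tail:
  assumes "0 < \<nu>" "0 < x" "0 \<le> t" shows "ennreal (tail \<nu> t x) = heat_tail \<nu> t x"
proof -
  have "heat_tail \<nu> t x \<le> ennreal (2 powr \<nu> * Gamma \<nu> * x powr (- 2 * \<nu>))"
    using heat_tail_antimono[OF assms(3)] heat_tail_zero[OF assms(1,2)] by metis
  then show ?thesis unfolding tail_def by (auto intro!: ennreal_enn2real simp: le_less_trans)
qed

lemma tail_zero: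
  "0 < \<nu> \<Longrightarrow> 0 < x \<Longrightarrow> tail \<nu> 0 x = 2 powr \<nu> * Gamma \<nu> * x powr (- 2 * \<nu>)"
  unfolding tail_def by (simp add: heat_tail_zero Gamma_real_pos less_imp_le)

lemma tail_antimono:
  assumes "0 < \<nu>" "0 < x" "0 \<le> s" "s \<le> t" shows "tail \<nu> t x \<le> tail \<nu> s x"
  using heat_tail_antimono[OF assms(4), of \<nu> x] assms tail_nonneg
  by (simp add: ennreal_tail[symmetric])

lemma tail_le:
  assumes "0 < \<nu>" "0 < x" "0 < t" shows "tail \<nu> t x \<le> t powr (- \<nu>) / \<nu>"
  using heat_tail_le[of \<nu> t x] assms by (simp add: ennreal_tail[symmetric])

lemma tail_ge:
  assumes "0 < \<nu>" "0 < x" "0 < t"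
  shows "t powr (- \<nu>) / \<nu> - x\<^sup>2 / (2 * (\<nu> + 1)) * t powr (- \<nu> - 1) \<le> tail \<nu> t x"
proof -
  have "0 \<le> x\<^sup>2 / (2 * (\<nu> + 1)) * t powr (- \<nu> - 1)" using assms by simp
  then have "ennreal (t powr (- \<nu>) / \<nu>) \<le> ennreal (tail \<nu> t x + x\<^sup>2 / (2 * (\<nu> + 1)) * t powr (- \<nu> - 1))"
    using heat_tail_ge[of \<nu> t x] assms tail_nonneg
    by (subst ennreal_plus) (simp_all add: ennreal_tail)
  then show ?thesis using assms tail_nonneg[of \<nu> t x] by (subst (asm) ennreal_le_iff) auto
qed

text \<open>Monotone functions are Borel. The constant continuation to negative times makes the
  function antitone on the whole line; only its values at \<open>t \<ge> 0\<close> matter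
  later.\<close>

lemma mono_tail_measurable:
  assumes "0 < \<nu>" "0 < x" shows "(\<lambda>t. if 0 \<le> t then tail \<nu> t x else tail \<nu> 0 x) \<in> borel_measurable borel"
proof -
  have "mono (\<lambda>t. - (if 0 \<le> t then tail \<nu> t x else tail \<nu> 0 x))"
    using tail_antimono[OF assms] by (auto intro!: monoI)
  then have "(\<lambda>t. - (if 0 \<le> t then tail \<nu> t x else tail \<nu> 0 x)) \<in> borel_measurable borel"
    by (rule borel_measurable_mono)
  then show ?thesis by simp
qed

context bessel begin

text \<open>\<open>expectation_heat\<close> is integrated over \<open>S > T\<close> and the order of
  integration exchanged. The identity for \<open>u\<close> thus comes from the smooth kernels,
  without differentiating under the integral, although \<open>u(0, x)\<close> is reached at the
  horizon.\<close>

lemma nn_integral_heat_tail: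
  assumes T: "0 < T" and b: "0 < b" and a: "b < a"
  shows "(\<integral>\<^sup>+ w. (if stays b T w then heat_tail \<nu> 0 (w T) else heat_tail \<nu> (T - exit_time {b<..} T w) b) \<partial>P)
    = heat_tail \<nu> T a"
proof -
  let ?\<sigma> = "exit_time {b<..} T"
  define Y where "Y S w = (if stays b T w then heat \<nu> (S - T) (w T) else heat \<nu> (S - ?\<sigma> w) b)" for S w
  have [measurable]: "Measurable.pred P (stays b T)"
    using stays_sets[of T b] T unfolding pred_def by simp
  have [measurable]: "(\<lambda>w. w T) \<in> borel_measurable P" using T by (intro coordinate_measurable) simp
  have [measurable]: "?\<sigma> \<in> borel_measurable P"
    using T by (intro borel_measurable_filtration_P[OF exit_time_measurable]) auto
  have m: "(\<lambda>(S, w). ennreal (Y S w) * indicator {T<..} S) \<in> borel_measurable (lborel \<Otimes>\<^sub>M P)"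
    unfolding Y_def heat_def by measurable
  have Ym: "Y S \<in> borel_measurable P" for S unfolding Y_def heat_def by measurable
  interpret pair_sigma_finite lborel P
    by (simp add: pair_sigma_finite_def lborel.sigma_finite_measure_axioms sigma_finite_measure_axioms)
  have "heat_tail \<nu> T a = (\<integral>\<^sup>+ S. (\<integral>\<^sup>+ w. ennreal (Y S w) * indicator {T<..} S \<partial>P) \<partial>lborel)"
    unfolding heat_tail_def
  proof (rule nn_integral_cong)
    fix S :: real
    have "ennreal (heat \<nu> S a) = (\<integral>\<^sup>+ w. ennreal (Y S w) \<partial>P)" if "T < S"
    proof -
      have "Y S = (\<lambda>w. if stays b T w then heat \<nu> (S - T) (w T) else heat \<nu> (S - ?\<sigma> w) b)"
        by (simp add: Y_def fun_eq_iff)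
      then have "integrable P (Y S)" "expectation (Y S) = heat \<nu> S a"
        using expectation_heat[OF T b a that] by simp_all
      then show ?thesis by (subst nn_integral_eq_integral) (auto simp: Y_def heat_nonneg)
    qed
    then show "ennreal (heat \<nu> S a) * indicator {T<..} S = (\<integral>\<^sup>+ w. ennreal (Y S w) * indicator {T<..} S \<partial>P)"
      by (auto simp: indicator_def)
  qed
  also have "\<dots> = (\<integral>\<^sup>+ w. (\<integral>\<^sup>+ S. ennreal (Y S w) * indicator {T<..} S \<partial>lborel) \<partial>P)"
    by (rule Fubini'[OF m, symmetric])
  also have "\<dots> = (\<integral>\<^sup>+ w. (if stays b T w then heat_tail \<nu> 0 (w T) else heat_tail \<nu> (T - ?\<sigma> w) b) \<partial>P)"
    by (rule nn_integral_cong) (simp add: Y_def heat_tail_shift)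
  finally show ?thesis ..
qed

definition survival :: "real \<Rightarrow> real \<Rightarrow> real" where
  "survival b T = prob {w \<in> space P. stays b T w}"

lemma survival_indicator:
  assumes "0 \<le> T"
  shows "integrable P (\<lambda>w. of_bool (stays b T w) :: real)" "expectation (\<lambda>w. of_bool (stays b T w)) = survival b T"
proof -
  have eq: "(of_bool (stays b T w) :: real) = indicator {w \<in> space P. stays b T w} w" if "w \<in> space P" for w
    using that by (simp add: indicator_def)
  have "integrable P (\<lambda>w. indicator {w \<in> space P. stays b T w} w :: real)"
    using stays_sets[OF assms, of b] by (simp add: emeasure_eq_measure)
  then show "integrable P (\<lambda>w. of_bool (stays b T w) :: real)"
    by (rule Bochner_Integration.integrable_cong[OF refl eq, THEN iffD2, rotated]) simp
  have "expectation (\<lambda>w. of_bool (stays b T w)) = (expectation (indicator {w \<in> space P. stays b T w}) :: real)"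
    by (intro Bochner_Integration.integral_cong refl eq)
  also have "\<dots> = survival b T"
    using stays_sets[OF assms, of b] by (auto simp: survival_def intro!: arg_cong[where f=prob])
  finally show "expectation (\<lambda>w. of_bool (stays b T w)) = survival b T" .
qed

lemma stays_antimono: "stays b t w \<Longrightarrow> s \<le> t \<Longrightarrow> stays b s w"
  unfolding stays_def by auto

lemma stays_iff_less_exit_time:
  assumes "w \<in> space P" "0 \<le> t" "t < T"
  shows "stays b t w \<longleftrightarrow> t < exit_time {b<..} T w"
  using less_exit_time_iff[of T w "{b<..}" t] path_continuous[of w 0 T] assms by (simp add: stays_def)

text \<open>Discarding the surviving paths in \<open>expectation_scale\<close> leaves
  \<open>b powr (- 2 * \<nu>)\<close> times the probability of a hit by time
  \<open>T\<close>.\<close>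

lemma survival_lower_bound:
  assumes T: "0 < T" and b: "0 < b" and a: "b < a"
  shows "1 - survival b T \<le> (b / a) powr (2 * \<nu>)"
proof -
  have "b powr (- 2 * \<nu>) * (1 - survival b T) = expectation (\<lambda>w. b powr (- 2 * \<nu>) * (1 - of_bool (stays b T w)))"
    using survival_indicator[of T b] T prob_space by simp
  also have "\<dots> \<le> expectation (\<lambda>w. if stays b T w then w T powr (- 2 * \<nu>) else b powr (- 2 * \<nu>))"
    using survival_indicator[of T b] T
    by (intro integral_mono expectation_scale T b a) auto
  also have "\<dots> = a powr (- 2 * \<nu>)" by (rule expectation_scale[OF T b a])
  finally have "b powr (- 2 * \<nu>) * (1 - survival b T) \<le> a powr (- 2 * \<nu>)" .
  moreover have "(b / a) powr (2 * \<nu>) = a powr (- 2 * \<nu>) / b powr (- 2 * \<nu>)"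
    using a b by (simp add: powr_divide powr_minus field_simps)
  moreover have "0 < b powr (- 2 * \<nu>)" using b by simp
  ultimately show ?thesis by (simp only: pos_le_divide_eq mult.commute)
qed

text \<open>By the lemma \<open>prob_hitting_time\<close> below, the left-hand side is a multiple of the probability
  of hitting \<open>b\<close> after time \<open>T\<close>.\<close>

lemma survival_identity:
  assumes T: "0 < T" and b: "0 < b" and a: "b < a"
  shows "tail \<nu> 0 b * (survival b T - (1 - (b / a) powr (2 * \<nu>)))
      = tail \<nu> T a - expectation (\<lambda>w. if stays b T w then 0 else tail \<nu> (T - exit_time {b<..} T w) b)"
    and "integrable P (\<lambda>w. if stays b T w then 0 else tail \<nu> (T - exit_time {b<..} T w) b)"
proof -
  let ?\<sigma> = "exit_time {b<..} T"
  let ?C = "2 powr \<nu> * Gamma \<nu>"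
  let ?R = "\<lambda>w. if stays b T w then w T powr (- 2 * \<nu>) else b powr (- 2 * \<nu>)"
  \<comment> \<open>On surviving paths the tail at time 0 is written out by
    \<open>heat_tail_zero\<close>, so that it is visibly \<open>?C\<close> times the scale function
    in \<open>?R\<close>.\<close>
  define Y where "Y w = (if stays b T w then ?C * w T powr (- 2 * \<nu>) else tail \<nu> (T - ?\<sigma> w) b)" for w
  have C: "0 < ?C" using index_pos by (simp add: Gamma_real_pos)
  have \<sigma>: "0 \<le> T - ?\<sigma> w" for w using exit_time_bounds(2)[of T "{b<..}" w] T by simp
  have pred [measurable]: "Measurable.pred P (stays b T)"
    using stays_sets[of T b] T unfolding pred_def by simp
  have [measurable]: "(\<lambda>w. w T) \<in> borel_measurable P" using T by (intro coordinate_measurable) simp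
  have [measurable]: "?\<sigma> \<in> borel_measurable P"
    using T by (intro borel_measurable_filtration_P[OF exit_time_measurable]) auto
  have [measurable]: "(\<lambda>w. tail \<nu> (T - ?\<sigma> w) b) \<in> borel_measurable P"
  proof -
    have "(\<lambda>w. T - ?\<sigma> w) \<in> borel_measurable P" by measurable
    from measurable_compose[OF this mono_tail_measurable[OF index_pos b]] show ?thesis using \<sigma> by simp
  qed
  have Ym: "Y \<in> borel_measurable P" unfolding Y_def by measurable
  have "(\<integral>\<^sup>+ w. ennreal (Y w) \<partial>P) = heat_tail \<nu> T a"
    unfolding nn_integral_heat_tail[OF T b a, symmetric]
  proof (rule nn_integral_cong)
    fix w
    have "0 < w T" if "stays b T w"
      using bspec[OF that[unfolded stays_def], of T] T b by simp
    then show "ennreal (Y w) = (if stays b T w then heat_tail \<nu> 0 (w T) else heat_tail \<nu> (T - ?\<sigma> w) b)"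
      using heat_tail_zero[OF index_pos] ennreal_tail[OF index_pos b \<sigma>] by (simp add: Y_def)
  qed
  also have "\<dots> = ennreal (tail \<nu> T a)" using ennreal_tail index_pos a b T by simp
  finally have "has_bochner_integral P Y (tail \<nu> T a)"
    using C by (intro has_bochner_integral_nn_integral Ym tail_nonneg) (auto simp: Y_def tail_nonneg)
  then have Y: "integrable P Y" "expectation Y = tail \<nu> T a"
    by (auto simp: has_bochner_integral_iff)
  note R = expectation_scale[OF T b a]
  have I: "integrable P (\<lambda>w. of_bool (stays b T w) :: real)" "expectation (\<lambda>w. of_bool (stays b T w)) = survival b T"
    using survival_indicator[of T b] T by auto
  \<comment> \<open>Subtracting \<open>?C * ?R\<close> removes the surviving paths; the last term
    restores what this took from the others.\<close>
  have eq: "(if stays b T w then 0 else tail \<nu> (T - ?\<sigma> w) b)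
      = Y w - ?C * ?R w + ?C * b powr (- 2 * \<nu>) * (1 - of_bool (stays b T w))" for w
    by (simp add: Y_def)
  show "integrable P (\<lambda>w. if stays b T w then 0 else tail \<nu> (T - ?\<sigma> w) b)"
    unfolding eq using Y R I by simp
  have "expectation (\<lambda>w. if stays b T w then 0 else tail \<nu> (T - ?\<sigma> w) b)
      = expectation Y - ?C * expectation ?R + ?C * b powr (- 2 * \<nu>) * (1 - expectation (\<lambda>w. of_bool (stays b T w)))"
    unfolding eq using Y(1) R(2) I(1) prob_space by simp
  also have "\<dots> = tail \<nu> T a - ?C * a powr (- 2 * \<nu>) + tail \<nu> 0 b * (1 - survival b T)"
    unfolding Y(2) R(1) I(2) tail_zero[OF index_pos b] ..
  also have "?C * a powr (- 2 * \<nu>) = tail \<nu> 0 b * (b / a) powr (2 * \<nu>)"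
    using a b unfolding tail_zero[OF index_pos b] by (simp add: powr_divide powr_minus field_simps)
  finally show "tail \<nu> 0 b * (survival b T - (1 - (b / a) powr (2 * \<nu>)))
      = tail \<nu> T a - expectation (\<lambda>w. if stays b T w then 0 else tail \<nu> (T - ?\<sigma> w) b)"
    by (simp add: algebra_simps)
qed

end

section \<open>The hitting time in terms of survival events\<close>

lemma less_hitting_time_iff:
  assumes w: "continuous_on {0..} w" and t: "0 < t"
  shows "ereal t < hitting_time b w \<longleftrightarrow> (\<forall>s\<in>{0<..t}. w s \<noteq> b)"
proof
  assume *: "ereal t < hitting_time b w"
  have "ereal s \<le> ereal t \<Longrightarrow> \<not> (0 < s \<and> w s = b)" for s
    using * unfolding hitting_time_def by (metis (mono_tags, lifting) Inf_lower mem_Collect_eq not_le order_trans)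
  then show "\<forall>s\<in>{0<..t}. w s \<noteq> b" by auto
next
  assume *: "\<forall>s\<in>{0<..t}. w s \<noteq> b"
  have "w t \<noteq> b" using * t by simp
  \<comment> \<open>Avoiding \<open>b\<close> up to \<open>t\<close> only bounds the infimum below
    by \<open>t\<close>. Continuity at \<open>t\<close> adds a gap of length
    \<open>\<delta>\<close>, which makes the inequality strict.\<close>
  moreover have "isCont w t" using w t by (intro continuous_on_interior[OF w]) simp
  ultimately have "eventually (\<lambda>s. w s \<noteq> b) (at t)"
    unfolding isCont_def by (intro tendsto_imp_eventually_ne)
  then obtain \<delta> where \<delta>: "0 < \<delta>" "\<And>s. s \<noteq> t \<Longrightarrow> dist s t < \<delta> \<Longrightarrow> w s \<noteq> b"
    unfolding eventually_at by auto
  have "ereal (t + \<delta>) \<le> hitting_time b w"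
    unfolding hitting_time_def
  proof (rule Inf_greatest)
    fix x assume "x \<in> {ereal s |s. 0 < s \<and> w s = b}"
    then obtain s where s: "x = ereal s" "0 < s" "w s = b" by auto
    then have "t < s" using * by (metis greaterThanAtMost_iff not_le)
    moreover have "\<not> dist s t < \<delta>" using \<delta>(2)[of s] s \<open>t < s\<close> by auto
    ultimately show "ereal (t + \<delta>) \<le> x" using s by (simp add: dist_real_def)
  qed
  moreover have "ereal t < ereal (t + \<delta>)" using \<delta>(1) by simp
  ultimately show "ereal t < hitting_time b w" by (rule less_le_trans[rotated])
qed

lemma hitting_time_finite_iff: "hitting_time b w < \<infinity> \<longleftrightarrow> (\<exists>n. \<exists>s\<in>{0<..real (Suc n)}. w s = b)"
proof
  assume "hitting_time b w < \<infinity>"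
  then obtain s where s: "0 < s" "w s = b" unfolding hitting_time_def Inf_less_iff by auto
  obtain n where "s \<le> real n" using real_arch_simple by blast
  then have "s \<in> {0<..real (Suc n)}" using s by simp
  then show "\<exists>n. \<exists>s\<in>{0<..real (Suc n)}. w s = b" using s by blast
next
  assume "\<exists>n. \<exists>s\<in>{0<..real (Suc n)}. w s = b"
  then obtain s where "0 < s" "w s = b" by auto
  then have "hitting_time b w \<le> ereal s" unfolding hitting_time_def by (intro Inf_lower) auto
  then show "hitting_time b w < \<infinity>" by (rule order_le_less_trans) simp
qed

context bessel begin

lemma hits_iff_not_stays:
  assumes w: "w \<in> space P" "b < w 0" and t: "0 < t"
  shows "(\<exists>s\<in>{0<..t}. w s = b) \<longleftrightarrow> \<not> stays b t w"
proof
  show "\<not> stays b t w" if "\<exists>s\<in>{0<..t}. w s = b" using that by (force simp: stays_def)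
  assume "\<not> stays b t w"
  then obtain r where r: "0 \<le> r" "r \<le> t" "w r \<le> b" by (force simp: stays_def)
  have "\<exists>s\<ge>0. s \<le> r \<and> w s = b"
    using r w path_continuous[of w 0 r] by (intro IVT2') auto
  then obtain s where s: "0 \<le> s" "s \<le> r" "w s = b" by auto
  moreover have "s \<noteq> 0" using s w by auto
  ultimately show "\<exists>s\<in>{0<..t}. w s = b" using r by (intro bexI[of _ s]) auto
qed

text \<open>The half-open time interval is exhausted by compact ones, for which
  \<open>hits_closed_measurable\<close> is available.\<close>

lemma hits_sets:
  assumes "0 < t" shows "{w \<in> space P. \<exists>s\<in>{0<..t}. w s = b} \<in> sets P"
proof -
  have "(\<exists>s\<in>{0<..t}. w s = b) \<longleftrightarrow> (\<exists>n. \<exists>s\<in>{inverse (real (Suc n))..t}. w s \<in> {b})" for w :: "real \<Rightarrow> real"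
  proof
    assume "\<exists>s\<in>{0<..t}. w s = b"
    then obtain s where s: "0 < s" "s \<le> t" "w s = b" by auto
    obtain n where "inverse (real (Suc n)) < s" using reals_Archimedean s(1) by blast
    then show "\<exists>n. \<exists>s\<in>{inverse (real (Suc n))..t}. w s \<in> {b}"
      using s by (intro exI[of _ n] bexI[of _ s]) auto
  next
    assume "\<exists>n. \<exists>s\<in>{inverse (real (Suc n))..t}. w s \<in> {b}"
    then obtain n s where s: "s \<in> {inverse (real (Suc n))..t}" "w s = b" by auto
    moreover have "0 < inverse (real (Suc n))" by simp
    ultimately have "0 < s" by (meson atLeastAtMost_iff less_le_trans)
    then show "\<exists>s\<in>{0<..t}. w s = b" using s by auto
  qed
  then have "{w \<in> space P. \<exists>s\<in>{0<..t}. w s = b}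
      = (\<Union>n. {w \<in> space path_space. \<exists>s\<in>{inverse (real (Suc n))..t}. w s \<in> {b}})"
    by auto
  also have "\<dots> \<in> sets P"
    by (intro sets.countable_UN image_subsetI sets_filtration_P[OF hits_closed_measurable[of _ t t]]) auto
  finally show ?thesis .
qed

lemma survival_antimono: "0 \<le> s \<Longrightarrow> s \<le> t \<Longrightarrow> survival b t \<le> survival b s"
  unfolding survival_def using stays_antimono by (intro finite_measure_mono stays_sets) auto

section \<open>A priori bounds for late hits and for short windows\<close>

lemma excess_nonneg:
  assumes "0 < T" "0 < b" "b < a"
  shows "0 \<le> survival b T - (1 - (b / a) powr (2 * \<nu>))"
  using survival_lower_bound[OF assms] by simp

text \<open>Dropping the nonnegative expectation in \<open>survival_identity\<close> gives the right
  order. This rough bound yields the limit of \<open>survival\<close> and is fed back into the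
  identity for the sharp asymptotics.\<close>

lemma excess_le:
  assumes T: "0 < T" and b: "0 < b" and a: "b < a"
  shows "survival b T - (1 - (b / a) powr (2 * \<nu>)) \<le> 1 / (tail \<nu> 0 b * \<nu>) * T powr (- \<nu>)"
proof -
  have pos: "0 < tail \<nu> 0 b"
    using index_pos b by (simp add: tail_zero Gamma_real_pos)
  have "0 \<le> expectation (\<lambda>w. if stays b T w then 0 else tail \<nu> (T - exit_time {b<..} T w) b)"
    by (intro integral_nonneg_AE AE_I2) (simp add: tail_nonneg)
  then have "tail \<nu> 0 b * (survival b T - (1 - (b / a) powr (2 * \<nu>))) \<le> tail \<nu> T a"
    using survival_identity(1)[OF T b a] by linarith
  also have "\<dots> \<le> T powr (- \<nu>) / \<nu>" using index_pos b a T by (intro tail_le) auto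
  finally show ?thesis using pos index_pos by (simp add: field_simps)
qed

lemma survival_tendsto:
  assumes b: "0 < b" and a: "b < a"
  shows "(\<lambda>n. survival b (real (Suc n))) \<longlonglongrightarrow> 1 - (b / a) powr (2 * \<nu>)"
proof -
  let ?p = "(b / a) powr (2 * \<nu>)" and ?A = "1 / (tail \<nu> 0 b * \<nu>)"
  have "(\<lambda>n. real (Suc n) powr (- \<nu>)) \<longlonglongrightarrow> 0"
    by (intro tendsto_neg_powr filterlim_compose[OF filterlim_real_sequentially filterlim_Suc])
      (use index_pos in auto)
  then have "(\<lambda>n. ?A * real (Suc n) powr (- \<nu>)) \<longlonglongrightarrow> ?A * 0" by (intro tendsto_intros)
  then have lim: "(\<lambda>n. ?A * real (Suc n) powr (- \<nu>)) \<longlonglongrightarrow> 0" by (simp only: mult_zero_right)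
  have "(\<lambda>n. survival b (real (Suc n)) - (1 - ?p)) \<longlonglongrightarrow> 0"
  proof (rule tendsto_sandwich[OF _ _ tendsto_const lim])
    show "eventually (\<lambda>n. 0 \<le> survival b (real (Suc n)) - (1 - ?p)) sequentially"
      by (intro always_eventually allI excess_nonneg b a) simp
    show "eventually (\<lambda>n. survival b (real (Suc n)) - (1 - ?p) \<le> ?A * real (Suc n) powr (- \<nu>)) sequentially"
      by (intro always_eventually allI excess_le b a) simp
  qed
  then show ?thesis by (simp add: LIM_zero_iff)
qed

text \<open>The paths never hit form the decreasing limit of the survival events, whose probability
  is known from \<open>survival_tendsto\<close>. The events agree only almost surely, because
  hitting and failing to stay above \<open>b\<close> coincide for paths started above
  \<open>b\<close>.\<close>

lemma prob_hitting_time: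
  assumes t: "0 < t" and b: "0 < b" and a: "b < a"
  shows "prob {w \<in> space P. ereal t < hitting_time b w \<and> hitting_time b w < \<infinity>}
      = survival b t - (1 - (b / a) powr (2 * \<nu>))"
proof -
  let ?H = "\<lambda>t. {w \<in> space P. \<exists>s\<in>{0<..t}. w s = b}"
  define D where "D n = {w \<in> space P. stays b (real (Suc n)) w}" for n
  have D: "range D \<subseteq> sets P" unfolding D_def using stays_sets by auto
  have dec: "decseq D" unfolding D_def using stays_antimono by (auto intro!: decseq_SucI) 
  let ?E = "{w \<in> space P. stays b t w} - (\<Inter>n. D n)"
  have "(\<lambda>n. prob (D n)) \<longlonglongrightarrow> prob (\<Inter>n. D n)" by (rule finite_Lim_measure_decseq[OF D dec])
  then have lim: "prob (\<Inter>n. D n) = 1 - (b / a) powr (2 * \<nu>)"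
    using survival_tendsto[OF b a] unfolding D_def survival_def by (rule LIMSEQ_unique)
  have eq: "{w \<in> space P. ereal t < hitting_time b w \<and> hitting_time b w < \<infinity>}
      = (space P - ?H t) \<inter> (\<Union>n. ?H (real (Suc n)))"
  proof -
    have "ereal t < hitting_time b w \<longleftrightarrow> (\<forall>s\<in>{0<..t}. w s \<noteq> b)" if "w \<in> space P" for w
      using that by (intro less_hitting_time_iff t) (auto simp: space_path_space)
    then show ?thesis using hitting_time_finite_iff by auto
  qed
  have "prob {w \<in> space P. ereal t < hitting_time b w \<and> hitting_time b w < \<infinity>} = prob ?E"
  proof (rule finite_measure_eq_AE)
    have "AE w in P. w \<in> space P" by (rule AE_space)
    with start show "AE w in P. (w \<in> {w \<in> space P. ereal t < hitting_time b w \<and> hitting_time b w < \<infinity>}) = (w \<in> ?E)"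
    proof eventually_elim
      case (elim w)
      have "b < w 0" using elim a by simp
      note H = hits_iff_not_stays[OF elim(2) this]
      show ?case unfolding eq D_def using elim H[OF t] H[of "real (Suc n)" for n] by auto
    qed
    show "{w \<in> space P. ereal t < hitting_time b w \<and> hitting_time b w < \<infinity>} \<in> sets P"
      unfolding eq using t
      by (intro sets.Int sets.Diff sets.top sets.countable_UN image_subsetI hits_sets) auto
    show "?E \<in> sets P" using t D by (intro sets.Diff stays_sets sets.countable_INT) auto
  qed
  also have "prob ?E = prob {w \<in> space P. stays b t w} - prob (\<Inter>n. D n)"
  proof (rule finite_measure_Diff)
    show "(\<Inter>n. D n) \<subseteq> {w \<in> space P. stays b t w}"
    proof
      fix w assume w: "w \<in> (\<Inter>n. D n)"
      obtain n where "t \<le> real n" using real_arch_simple by blast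
      moreover have "w \<in> D n" using w by auto
      ultimately show "w \<in> {w \<in> space P. stays b t w}"
        unfolding D_def using stays_antimono[of b "real (Suc n)" w t] by auto
    qed
  qed (use t D in \<open>auto intro!: stays_sets sets.countable_INT simp del: space_P\<close>)
  finally show ?thesis unfolding lim survival_def .
qed

text \<open>For a path hit in the window, \<open>S = s + 2\<close> leaves a remaining time between 1
  and 2, where the kernel at \<open>b\<close> is at least \<open>c\<close>. So \<open>c\<close>
  times the window probability is at most the whole expectation \<open>heat \<nu> (s + 2) a\<close>,
  which carries the extra power of \<open>s\<close>.\<close>

lemma survival_window:
  assumes s: "0 < s" and b: "0 < b" and a: "b < a"
  shows "survival b s - survival b (s + 1) \<le> 2 powr (\<nu> + 1) * exp (b\<^sup>2 / 2) * s powr (- \<nu> - 1)"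
proof -
  define c where "c = 2 powr (- \<nu> - 1) * exp (- (b\<^sup>2 / 2))"
  have c: "0 < c" by (simp add: c_def)
  let ?Y = "\<lambda>w. if stays b (s + 1) w then heat \<nu> (s + 2 - (s + 1)) (w (s + 1))
      else heat \<nu> (s + 2 - exit_time {b<..} (s + 1) w) b"
  note I = survival_indicator[of s b] survival_indicator[of "s + 1" b]
  have heat_ge: "c \<le> heat \<nu> r b" if "1 \<le> r" "r \<le> 2" for r
  proof -
    have "2 powr (- \<nu> - 1) \<le> r powr (- \<nu> - 1)" using that index_pos by (intro powr_mono2') auto
    moreover have "b\<^sup>2 / (2 * r) \<le> b\<^sup>2 / 2" using that by (intro divide_left_mono) auto
    ultimately show ?thesis unfolding c_def heat_def by (intro mult_mono) auto
  qed
  have "c * (survival b s - survival b (s + 1))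
      = expectation (\<lambda>w. c * (of_bool (stays b s w) - of_bool (stays b (s + 1) w)))"
    using I s by simp
  also have "\<dots> \<le> expectation ?Y"
  proof (rule integral_mono)
    show "integrable P ?Y" using s by (intro expectation_heat(2)[OF _ b a]) auto
    fix w assume w: "w \<in> space P"
    show "c * (of_bool (stays b s w) - of_bool (stays b (s + 1) w)) \<le> ?Y w"
    proof (cases "stays b s w \<and> \<not> stays b (s + 1) w")
      case True
      then have "s < exit_time {b<..} (s + 1) w"
        using stays_iff_less_exit_time[OF w, of s "s + 1" b] s by simp
      then show ?thesis
        using True exit_time_bounds(2)[of "s + 1" "{b<..}" w] s by (auto intro!: heat_ge)
    next
      case False
      then show ?thesis using stays_antimono[of b "s + 1" w s] c by (auto simp: heat_nonneg)
    qed
  qed (use I s in simp)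
  also have "\<dots> = heat \<nu> (s + 2) a" using s by (intro expectation_heat(1)[OF _ b a]) auto
  also have "\<dots> \<le> (s + 2) powr (- \<nu> - 1)" using s by (intro heat_le) auto
  also have "\<dots> \<le> s powr (- \<nu> - 1)" using s index_pos by (intro powr_mono2') auto
  finally have "survival b s - survival b (s + 1) \<le> s powr (- \<nu> - 1) / c"
    using c by (simp add: pos_le_divide_eq mult.commute)
  also have "\<dots> = 2 powr (\<nu> + 1) * exp (b\<^sup>2 / 2) * s powr (- \<nu> - 1)"
  proof -
    have e: "- \<nu> - 1 = - (\<nu> + 1)" by simp
    have "c = 1 / (2 powr (\<nu> + 1) * exp (b\<^sup>2 / 2))"
      unfolding c_def e powr_minus_divide by (simp add: exp_minus field_simps)
    then show ?thesis by simp
  qed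
  finally show ?thesis .
qed

lemma survival_windows:
  assumes s: "0 < s" and b: "0 < b" and a: "b < a"
  shows "survival b s - survival b (s + real n) \<le> real n * (2 powr (\<nu> + 1) * exp (b\<^sup>2 / 2) * s powr (- \<nu> - 1))"
proof (induction n)
  case (Suc n)
  have "survival b (s + n) - survival b (s + n + 1) \<le> 2 powr (\<nu> + 1) * exp (b\<^sup>2 / 2) * (s + n) powr (- \<nu> - 1)"
    using s by (intro survival_window b a) auto
  also have "\<dots> \<le> 2 powr (\<nu> + 1) * exp (b\<^sup>2 / 2) * s powr (- \<nu> - 1)"
    using s index_pos by (intro mult_left_mono powr_mono2') auto
  finally have "survival b (s + n) - survival b (s + real (Suc n)) \<le> 2 powr (\<nu> + 1) * exp (b\<^sup>2 / 2) * s powr (- \<nu> - 1)"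
    by (simp add: add_ac)
  with Suc show ?case by (simp add: algebra_simps)
qed simp

text \<open>The remaining time \<open>T - \<sigma>\<close> is at most \<open>T\<close> and
  \<open>tail\<close> is antitone. This crude estimate suffices for the upper half of the
  asymptotics.\<close>

lemma hit_contribution_ge:
  assumes T: "0 < T" and b: "0 < b" and a: "b < a"
  shows "(1 - survival b T) * tail \<nu> T b
    \<le> expectation (\<lambda>w. if stays b T w then 0 else tail \<nu> (T - exit_time {b<..} T w) b)"
proof -
  note I = survival_indicator[of T b]
  have "(1 - survival b T) * tail \<nu> T b = expectation (\<lambda>w. (1 - of_bool (stays b T w)) * tail \<nu> T b)"
    using I T prob_space by simp
  also have "\<dots> \<le> expectation (\<lambda>w. if stays b T w then 0 else tail \<nu> (T - exit_time {b<..} T w) b)"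
  proof (rule integral_mono)
    fix w
    show "(1 - of_bool (stays b T w)) * tail \<nu> T b \<le> (if stays b T w then 0 else tail \<nu> (T - exit_time {b<..} T w) b)"
      using exit_time_bounds[of T "{b<..}" w] T by (auto intro!: tail_antimono index_pos b)
  qed (use I T survival_identity(2)[OF T b a] in auto)
  finally show ?thesis .
qed

text \<open>The integrand is dominated by a step function of the hitting time: on each of four
  windows \<open>tail\<close> is bounded through its value at the smallest remaining time. On the
  last window this time is 0, where the power bound blows up, hence
  \<open>tail \<nu> 0 b\<close>.\<close>

lemma hit_contribution_le:
  assumes m: "0 < m" "2 * m \<le> T" and b: "0 < b" and a: "b < a"
  shows "expectation (\<lambda>w. if stays b T w then 0 else tail \<nu> (T - exit_time {b<..} T w) b)
    \<le> (T - m) powr (- \<nu>) / \<nu> * (1 - survival b m) + (T / 2) powr (- \<nu>) / \<nu> * (survival b m - survival b (T / 2))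
      + m powr (- \<nu>) / \<nu> * (survival b (T / 2) - survival b (T - m))
      + tail \<nu> 0 b * (survival b (T - m) - survival b T)" (is "expectation ?J \<le> ?R")
proof -
  have T: "0 < T" using m by simp
  let ?I = "\<lambda>t w. of_bool (stays b t w) :: real"
  let ?c1 = "(T - m) powr (- \<nu>) / \<nu>" and ?c2 = "(T / 2) powr (- \<nu>) / \<nu>" and ?c3 = "m powr (- \<nu>) / \<nu>"
    and ?c4 = "tail \<nu> 0 b"
  let ?B = "\<lambda>w. ?c1 * (1 - ?I m w) + ?c2 * (?I m w - ?I (T / 2) w) + ?c3 * (?I (T / 2) w - ?I (T - m) w)
    + ?c4 * (?I (T - m) w - ?I T w)"
  note I = survival_indicator[of m b] survival_indicator[of "T / 2" b] survival_indicator[of "T - m" b]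
    survival_indicator[of T b]
  have "expectation ?J \<le> expectation ?B"
  proof (rule integral_mono)
    fix w assume w: "w \<in> space P"
    let ?\<sigma> = "exit_time {b<..} T w"
    have \<sigma>: "0 \<le> ?\<sigma>" "?\<sigma> \<le> T" using exit_time_bounds[of T "{b<..}" w] T by auto
    have st: "stays b t w \<longleftrightarrow> t < ?\<sigma>" if "0 \<le> t" "t < T" for t
      using stays_iff_less_exit_time[OF w that] .
    have le: "tail \<nu> (T - ?\<sigma>) b \<le> r powr (- \<nu>) / \<nu>" if "0 < r" "r \<le> T - ?\<sigma>" for r
      using tail_antimono[OF index_pos b, of r "T - ?\<sigma>"] tail_le[OF index_pos b, of r] that by simp
    have le0: "tail \<nu> (T - ?\<sigma>) b \<le> tail \<nu> 0 b" using \<sigma> by (intro tail_antimono index_pos b) auto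
    have mono: "stays b (T / 2) w \<Longrightarrow> stays b m w" "stays b (T - m) w \<Longrightarrow> stays b (T / 2) w"
      "stays b T w \<Longrightarrow> stays b (T - m) w"
      using m by (auto elim!: stays_antimono)
    consider "stays b T w" | "\<not> stays b T w" "stays b (T - m) w"
      | "\<not> stays b (T - m) w" "stays b (T / 2) w" | "\<not> stays b (T / 2) w" "stays b m w" | "\<not> stays b m w"
      by blast
    then show "?J w \<le> ?B w"
    proof cases
      case 1
      then show ?thesis using mono by simp
    next
      case 2
      then show ?thesis using mono le0 by simp
    next
      case 3
      then have "\<not> stays b T w" "stays b m w" using mono by auto
      moreover have "?\<sigma> \<le> T - m" using 3 st[of "T - m"] m T by simp
      ultimately show ?thesis using 3 le[of m] m by simp
    next
      case 4
      then have "\<not> stays b T w" "\<not> stays b (T - m) w" using mono by auto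
      moreover have "?\<sigma> \<le> T / 2" using 4 st[of "T / 2"] T by simp
      ultimately show ?thesis using 4 le[of "T / 2"] T by simp
    next
      case 5
      then have "\<not> stays b T w" "\<not> stays b (T - m) w" "\<not> stays b (T / 2) w" using mono by auto
      moreover have "?\<sigma> \<le> m" using 5 st[of m] T m by simp
      ultimately show ?thesis using 5 le[of "T - m"] T m by simp
    qed
  qed (use I T m survival_identity(2)[OF T b a] in auto)
  also have "expectation ?B = ?R" using I T m prob_space by simp
  finally show ?thesis .
qed

end

subsection \<open>Asymptotics\<close>

text \<open>Mean value theorem; the intermediate point exceeds \<open>T - m\<close>, hence
  \<open>T / 2\<close>.\<close>

lemma powr_shift_le:
  fixes \<nu> m T :: real
  assumes \<nu>: "0 < \<nu>" and m: "0 < m" "2 * m \<le> T"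
  shows "(T - m) powr (- \<nu>) \<le> T powr (- \<nu>) + \<nu> * m * (T / 2) powr (- \<nu> - 1)"
proof -
  have "\<exists>z>T - m. z < T \<and> T powr (- \<nu>) - (T - m) powr (- \<nu>) = (T - (T - m)) * (- \<nu> * z powr (- \<nu> - 1))"
    using m by (intro MVT2 has_real_derivative_powr) auto
  then obtain z where z: "T - m < z" "z < T"
    "T powr (- \<nu>) - (T - m) powr (- \<nu>) = (T - (T - m)) * (- \<nu> * z powr (- \<nu> - 1))" by auto
  have "z powr (- \<nu> - 1) \<le> (T / 2) powr (- \<nu> - 1)" using z m \<nu> by (intro powr_mono2') auto
  then have "\<nu> * m * z powr (- \<nu> - 1) \<le> \<nu> * m * (T / 2) powr (- \<nu> - 1)"
    using \<nu> m by (intro mult_left_mono) auto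
  then show ?thesis using z(3) by (simp add: algebra_simps)
qed

context bessel begin

text \<open>The hitting times in \<open>[0, m]\<close>, \<open>[m, T/2]\<close>, \<open>[T/2, T - m]\<close> and \<open>[T - m, T]\<close> contribute errors of
  order \<open>T powr (-\<nu>) * m / T\<close>, \<open>(T * m) powr (-\<nu>)\<close>, \<open>(T * m) powr (-\<nu>)\<close> and \<open>m * T powr (-\<nu> - 1)\<close>;
  the choice \<open>m = T powr (1 / (1 + \<nu>))\<close> balances them.\<close>

lemma excess_asymptotics:
  assumes b: "0 < b" and a: "b < a"
  defines "p \<equiv> (b / a) powr (2 * \<nu>)"
  shows "\<exists>K. eventually (\<lambda>T. \<bar>tail \<nu> 0 b * (survival b T - (1 - p)) - (1 - p) * T powr (- \<nu>) / \<nu>\<bar>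
    \<le> K * T powr (- \<nu> - \<nu> / (1 + \<nu>))) at_top"
proof -
  define \<theta> where "\<theta> = \<nu> / (1 + \<nu>)"
  define A where "A = 1 / (tail \<nu> 0 b * \<nu>)"
  define W where "W = 2 powr (\<nu> + 1) * exp (b\<^sup>2 / 2)"
  define ca cb where "ca = a\<^sup>2 / (2 * (\<nu> + 1))" and "cb = b\<^sup>2 / (2 * (\<nu> + 1))"
  \<comment> \<open>The four summands are the constants of \<open>t1\<close> to \<open>t4\<close>
    below; \<open>ca\<close> and \<open>cb\<close> come from \<open>tail_ge\<close> at
    \<open>a\<close> and at \<open>b\<close>.\<close>
  define K1 where "K1 = 2 powr (\<nu> + 1) + 2 powr \<nu> * A / \<nu> + 2 powr \<nu> * A / \<nu>
    + tail \<nu> 0 b * (2 * W * 2 powr (\<nu> + 1))"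
  define K where "K = max (A / \<nu> + cb) (ca + K1)"
  define m where "m T = T powr (1 / (1 + \<nu>))" for T :: real
  have \<nu>: "0 < \<nu>" by (rule index_pos)
  have tail0: "0 < tail \<nu> 0 b" using \<nu> b by (simp add: tail_zero Gamma_real_pos)
  have A: "0 < A" and W: "0 < W" and cab: "0 \<le> ca" "0 \<le> cb"
    using \<nu> tail0 by (auto simp: A_def W_def ca_def cb_def)
  have p: "0 \<le> p" "p \<le> 1" using b a \<nu> by (auto simp: p_def powr_le1)
  have \<theta>: "0 < \<theta>" "\<theta> \<le> \<nu>" "\<theta> \<le> 1" using \<nu> by (auto simp: \<theta>_def field_simps)
  have m_exp: "1 / (1 + \<nu>) = 1 - \<theta>" "1 / (1 + \<nu>) * \<nu> = \<theta>"
    using \<nu> by (auto simp: \<theta>_def field_simps)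
  \<comment> \<open>Since \<open>m T = T * T powr (- \<theta>)\<close>, this smallness is what gives
    \<open>2 * m T \<le> T\<close>.\<close>
  have "((\<lambda>T. T powr (- \<theta>)) \<longlongrightarrow> 0) at_top" using \<theta> by (intro tendsto_neg_powr filterlim_ident) simp
  then have "eventually (\<lambda>T. T powr (- \<theta>) < 1 / 2) at_top" by (rule order_tendstoD) simp
  moreover have "eventually (\<lambda>T::real. 1 \<le> T) at_top" by (rule eventually_ge_at_top)
  ultimately have "eventually (\<lambda>T. \<bar>tail \<nu> 0 b * (survival b T - (1 - p)) - (1 - p) * T powr (- \<nu>) / \<nu>\<bar>
    \<le> K * T powr (- \<nu> - \<theta>)) at_top"
  proof eventually_elim
    case (elim T)
    have T: "0 < T" using elim by simp
    define X T1 R where "X = T powr (- \<nu>)" and "T1 = T powr (- \<nu> - 1)" and "R = T powr (- \<nu> - \<theta>)"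
    have nn: "0 \<le> X" "0 \<le> T1" "0 \<le> R" by (auto simp: X_def T1_def R_def)
    have m1: "1 \<le> m T" using elim \<nu> by (simp add: m_def ge_one_powr_ge_zero)
    have "m T = T * T powr (- \<theta>)"
      using T powr_add[of T 1 "- \<theta>"] by (simp add: m_def m_exp(1))
    also have "\<dots> \<le> T * (1 / 2)" using elim T by (intro mult_left_mono) auto
    finally have mT: "2 * m T \<le> T" by simp
    have XX: "X * X \<le> R"
      unfolding X_def R_def powr_add[symmetric] using elim \<theta> by (intro powr_mono) auto
    have T1R: "T1 \<le> R" unfolding T1_def R_def using elim \<theta> by (intro powr_mono) auto
    have Xm: "X * m T powr (- \<nu>) = R"
    proof -
      have "m T powr (- \<nu>) = T powr (- \<theta>)" using m_exp(2) by (simp add: m_def powr_powr)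
      moreover have "- \<nu> - \<theta> = - \<nu> + - \<theta>" by simp
      ultimately show ?thesis unfolding X_def R_def by (simp only: powr_add)
    qed
    have mT1: "m T * T1 = R"
    proof -
      have "1 - \<theta> + (- \<nu> - 1) = - \<nu> - \<theta>" by simp
      then show ?thesis by (simp only: m_def T1_def R_def powr_add[symmetric] m_exp(1))
    qed
    have half: "(T / 2) powr (- \<nu>) = 2 powr \<nu> * X" "(T / 2) powr (- \<nu> - 1) = 2 powr (\<nu> + 1) * T1"
    proof -
      have h: "(T / 2) powr (- x) = 2 powr x * T powr (- x)" for x
        using T by (simp add: powr_divide powr_minus field_simps)
      show "(T / 2) powr (- \<nu>) = 2 powr \<nu> * X" unfolding X_def by (rule h)
      have "- \<nu> - 1 = - (\<nu> + 1)" by simp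
      then show "(T / 2) powr (- \<nu> - 1) = 2 powr (\<nu> + 1) * T1" unfolding T1_def using h by metis
    qed
    let ?s = "survival b" and ?q = "\<lambda>T. survival b T - (1 - p)"
    have q: "0 \<le> ?q t" "?q t \<le> A * t powr (- \<nu>)" if "0 < t" for t
      using excess_nonneg[OF that b a] excess_le[OF that b a] unfolding p_def A_def by auto
    have s1: "?s t \<le> 1" for t by (simp add: survival_def)
    let ?J = "expectation (\<lambda>w. if stays b T w then 0 else tail \<nu> (T - exit_time {b<..} T w) b)"
    have L: "tail \<nu> 0 b * ?q T = tail \<nu> T a - ?J"
      using survival_identity(1)[OF T b a] unfolding p_def .
    have tail_a: "tail \<nu> T a \<le> X / \<nu>" "X / \<nu> - ca * T1 \<le> tail \<nu> T a"
      using tail_le[of \<nu> a T] tail_ge[of \<nu> a T] \<nu> T a b unfolding X_def T1_def ca_def by auto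
    \<comment> \<open>Here \<open>1 - survival b T\<close> is \<open>p\<close> minus the excess
      \<open>?q T\<close>; replacing it by \<open>p\<close> costs \<open>?q T * X / \<nu>\<close>,
      which is quadratic in \<open>X\<close> by the a priori bound and hence absorbed by
      \<open>XX\<close>.\<close>
    have upper: "tail \<nu> 0 b * ?q T - (1 - p) * X / \<nu> \<le> (A / \<nu> + cb) * R"
    proof -
      have tb: "X / \<nu> - cb * T1 \<le> tail \<nu> T b"
        using tail_ge[of \<nu> b T] \<nu> T b unfolding X_def T1_def cb_def by auto
      have "(1 - ?s T) * (X / \<nu> - cb * T1) \<le> (1 - ?s T) * tail \<nu> T b"
        using s1[of T] by (intro mult_left_mono tb) auto
      also have "\<dots> \<le> ?J" by (rule hit_contribution_ge[OF T b a])
      finally have "(1 - ?s T) * (X / \<nu> - cb * T1) \<le> ?J" .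
      moreover have "(1 - ?s T) * (cb * T1) \<le> 1 * (cb * T1)"
        using cab nn by (intro mult_right_mono) (auto simp: survival_def)
      moreover have "?q T * (X / \<nu>) \<le> (A * X) * (X / \<nu>)"
        using q(2)[OF T] nn \<nu> unfolding X_def by (intro mult_right_mono) auto
      moreover have "A / \<nu> * (X * X) \<le> A / \<nu> * R" "cb * T1 \<le> cb * R"
        using mult_left_mono[OF XX, of "A / \<nu>"] mult_left_mono[OF T1R, of cb] A \<nu> cab by simp_all
      ultimately show ?thesis using tail_a(1) unfolding L by (simp add: algebra_simps diff_divide_distrib)
    qed
    have lower: "- ((ca + K1) * R) \<le> tail \<nu> 0 b * ?q T - (1 - p) * X / \<nu>"
    proof -
      let ?m = "m T"
      have m: "0 < ?m" using m1 by simp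
      have pos: "0 < T / 2" "0 < T - ?m" using T mT m by auto
      have t1: "(T - ?m) powr (- \<nu>) / \<nu> * (1 - ?s ?m) \<le> p * (X / \<nu>) + 2 powr (\<nu> + 1) * R"
      proof -
        have "(T - ?m) powr (- \<nu>) \<le> X + \<nu> * ?m * (2 powr (\<nu> + 1) * T1)"
          using powr_shift_le[OF \<nu> m mT] unfolding half X_def .
        also have "\<nu> * ?m * (2 powr (\<nu> + 1) * T1) = \<nu> * (2 powr (\<nu> + 1) * R)"
          unfolding mT1[symmetric] by (simp add: ac_simps)
        finally have "(T - ?m) powr (- \<nu>) / \<nu> \<le> X / \<nu> + 2 powr (\<nu> + 1) * R"
          using \<nu> by (simp add: field_simps)
        then have "(T - ?m) powr (- \<nu>) / \<nu> * (1 - ?s ?m) \<le> (X / \<nu> + 2 powr (\<nu> + 1) * R) * p"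
          using q(1)[OF m] s1[of ?m] nn \<nu> by (intro mult_mono) auto
        also have "\<dots> \<le> p * (X / \<nu>) + 2 powr (\<nu> + 1) * R"
          using p nn mult_left_le[of p "2 powr (\<nu> + 1) * R"] by (simp add: algebra_simps)
        finally show ?thesis .
      qed
      have t2: "(T / 2) powr (- \<nu>) / \<nu> * (?s ?m - ?s (T / 2)) \<le> 2 powr \<nu> * A / \<nu> * R"
      proof -
        have "?s ?m - ?s (T / 2) \<le> A * ?m powr (- \<nu>)" using q[OF m] q(1)[OF pos(1)] by linarith
        then have "2 powr \<nu> * X / \<nu> * (?s ?m - ?s (T / 2)) \<le> 2 powr \<nu> * X / \<nu> * (A * ?m powr (- \<nu>))"
          using nn \<nu> by (intro mult_left_mono) auto
        then show ?thesis unfolding half Xm[symmetric] by (simp add: ac_simps)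
      qed
      have t3: "?m powr (- \<nu>) / \<nu> * (?s (T / 2) - ?s (T - ?m)) \<le> 2 powr \<nu> * A / \<nu> * R"
      proof -
        have "?s (T / 2) - ?s (T - ?m) \<le> A * (2 powr \<nu> * X)"
          using q[OF pos(1)] q(1)[OF pos(2)] unfolding half by linarith
        then have "?m powr (- \<nu>) / \<nu> * (?s (T / 2) - ?s (T - ?m)) \<le> ?m powr (- \<nu>) / \<nu> * (A * (2 powr \<nu> * X))"
          using \<nu> by (intro mult_left_mono) auto
        then show ?thesis unfolding Xm[symmetric] by (simp add: ac_simps)
      qed
      have t4: "?s (T - ?m) - ?s T \<le> 2 * W * 2 powr (\<nu> + 1) * R"
      proof -
        \<comment> \<open>The last stretch is covered by \<open>n\<close> unit windows;
          \<open>m T \<ge> 1\<close> gives \<open>n \<le> 2 * m T\<close>. Rounding up passes beyond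
          \<open>T\<close>, which only enlarges the difference of survival probabilities.\<close>
        define n where "n = nat \<lceil>?m\<rceil>"
        have n: "?m \<le> real n" "real n \<le> 2 * ?m" using m1 unfolding n_def by linarith+
        have "?s (T - ?m + n) \<le> ?s T" using T n by (intro survival_antimono) auto
        then have "?s (T - ?m) - ?s T \<le> ?s (T - ?m) - ?s (T - ?m + n)" by simp
        also have "\<dots> \<le> real n * (W * (T - ?m) powr (- \<nu> - 1))"
          unfolding W_def by (rule survival_windows[OF pos(2) b a])
        also have "\<dots> \<le> (2 * ?m) * (W * (T / 2) powr (- \<nu> - 1))"
          using n W pos mT \<nu> by (intro mult_mono powr_mono2') auto
        also have "\<dots> = 2 * W * 2 powr (\<nu> + 1) * R"
          unfolding half mT1[symmetric] by (simp add: ac_simps)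
        finally show ?thesis .
      qed
      have "tail \<nu> 0 b * (?s (T - ?m) - ?s T) \<le> tail \<nu> 0 b * (2 * W * 2 powr (\<nu> + 1) * R)"
        using t4 tail0 by (intro mult_left_mono) auto
      moreover have "K1 * R = 2 powr (\<nu> + 1) * R + 2 powr \<nu> * A / \<nu> * R + 2 powr \<nu> * A / \<nu> * R
          + tail \<nu> 0 b * (2 * W * 2 powr (\<nu> + 1) * R)"
        unfolding K1_def by (simp only: distrib_right mult.assoc)
      ultimately have "?J \<le> p * (X / \<nu>) + K1 * R"
        using hit_contribution_le[OF m mT b a] t1 t2 t3 by linarith
      moreover have "ca * T1 \<le> ca * R" using T1R cab by (intro mult_left_mono)
      ultimately show ?thesis using tail_a(2) unfolding L by (simp add: algebra_simps diff_divide_distrib)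
    qed
    have "(A / \<nu> + cb) * R \<le> K * R" "(ca + K1) * R \<le> K * R"
      unfolding K_def using nn by (auto intro!: mult_right_mono)
    then show ?case using upper lower unfolding X_def R_def by (simp add: abs_le_iff)
  qed
  then show ?thesis unfolding \<theta>_def by blast
qed

end

theorem theorem1:
  fixes \<nu> a b \<epsilon> :: real and P :: "(real \<Rightarrow> real) measure"
  assumes "0 < \<nu>" and "0 < b" and "b < a"
    and "\<epsilon> \<in> {0<..<\<nu> / (1 + \<nu>)}"
    and "bessel_law \<nu> a P"
  shows "(\<lambda>t. measure P {w \<in> space P. ereal t < hitting_time b w \<and> hitting_time b w < \<infinity>}
             - b powr (2 * \<nu>) * (1 - (b / a) powr (2 * \<nu>)) * (1 / (Gamma (1 + \<nu>) * (2 * t) powr \<nu>)))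
         \<in> O[at_top](\<lambda>t. t powr (- \<nu> - \<epsilon>))"
proof -
  interpret bessel \<nu> a P by unfold_locales fact+
  let ?p = "(b / a) powr (2 * \<nu>)" and ?c = "tail \<nu> 0 b"
  have c: "0 < ?c" using assms by (simp add: tail_zero Gamma_real_pos)
  obtain K where "eventually (\<lambda>T. \<bar>?c * (survival b T - (1 - ?p)) - (1 - ?p) * T powr (- \<nu>) / \<nu>\<bar>
    \<le> K * T powr (- \<nu> - \<nu> / (1 + \<nu>))) at_top"
    using excess_asymptotics[OF assms(2,3)] by auto
  moreover have "eventually (\<lambda>T::real. 1 \<le> T) at_top" by (rule eventually_ge_at_top)
  ultimately have "eventually (\<lambda>t. norm (measure P {w \<in> space P. ereal t < hitting_time b w \<and> hitting_time b w < \<infinity>}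
             - b powr (2 * \<nu>) * (1 - ?p) * (1 / (Gamma (1 + \<nu>) * (2 * t) powr \<nu>)))
    \<le> \<bar>K\<bar> / ?c * norm (t powr (- \<nu> - \<epsilon>))) at_top"
  proof eventually_elim
    case (elim t)
    have t: "0 < t" using elim by simp
    define D where "D = 1 / (Gamma (1 + \<nu>) * (2 * t) powr \<nu>)"
    let ?f = "survival b t - (1 - ?p) - b powr (2 * \<nu>) * (1 - ?p) * D"
    \<comment> \<open>The constant of the theorem: \<open>?c\<close> is
      \<open>2 powr \<nu> * Gamma \<nu> * b powr (- 2 * \<nu>)\<close>, and
      \<open>Gamma (1 + \<nu>) = \<nu> * Gamma \<nu>\<close> leaves the factor
      \<open>1 / \<nu>\<close>.\<close>
    have D: "?c * (b powr (2 * \<nu>) * D) = t powr (- \<nu>) / \<nu>"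
    proof -
      have "Gamma (1 + \<nu>) = \<nu> * Gamma \<nu>"
        using Gamma_plus1[of \<nu>] assms(1) by (auto simp: add.commute nonpos_Ints_def)
      moreover have "Gamma \<nu> \<noteq> 0" using Gamma_real_pos[OF assms(1)] by simp
      moreover have "b powr (- 2 * \<nu>) * b powr (2 * \<nu>) = 1" using assms(2) by (simp add: powr_minus)
      ultimately show ?thesis
        using t assms(1,2) by (simp add: D_def tail_zero powr_mult powr_minus field_simps)
    qed
    have "?c * ?f = ?c * (survival b t - (1 - ?p)) - (1 - ?p) * (?c * (b powr (2 * \<nu>) * D))"
      by (simp add: algebra_simps)
    then have "?c * ?f = ?c * (survival b t - (1 - ?p)) - (1 - ?p) * t powr (- \<nu>) / \<nu>"
      unfolding D by simp
    then have "?c * \<bar>?f\<bar> \<le> K * t powr (- \<nu> - \<nu> / (1 + \<nu>))"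
      using elim(1) c by (simp add: abs_mult_pos'[symmetric])
    \<comment> \<open>For \<open>t \<ge> 1\<close> the smaller \<open>\<epsilon>\<close> gives the
      larger power. The sign of \<open>K\<close> is not known, hence the absolute value.\<close>
    also have "\<dots> \<le> \<bar>K\<bar> * t powr (- \<nu> - \<epsilon>)"
      using elim(2) assms(4) by (intro mult_mono powr_mono) auto
    finally have "\<bar>?f\<bar> \<le> \<bar>K\<bar> / ?c * t powr (- \<nu> - \<epsilon>)" using c by (simp add: field_simps)
    then show ?case
      unfolding prob_hitting_time[OF t assms(2,3)] D_def by simp
  qed
  then show ?thesis by (rule bigoI)
qed

end
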